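(* Let $p>1$ and $h\in(0,1)$ be fixed, and let $a_h:[0,1]\to\{0,1\}$ be given by $a_h(x)=1$ for $x\in[0,\tfrac{1-h}{2}]\cup[\tfrac{1+h}{2},1]$ and $a_h(x)=0$ for $x\in(\tfrac{1-h}{2},\tfrac{1+h}{2})$. For every $\lambda\in(-\infty,\pi^2)$, the problem $$-u''=\lambda u+a_h(x)u^p \ \text{ in } (0,1),\qquad u(0)=u(1)=0,$$ has a unique symmetric positive solution. Consequently, this problem has a positive solution if, and only if, $\lambda<\pi^2$.
   Context: A solution is a function $u\in\mathcal{C}^1([0,1])$ with $u'$ absolutely continuous satisfying the differential equation almost everywhere (equivalently, a $\mathcal{C}^2$ solution on each interval where $a_h$ is constant, glued in a $\mathcal{C}^1$ way) and the boundary conditions. A positive solution is a solution with $u(x)>0$ for all $x\in(0,1)$. A solution is symmetric if $u(x)=u(1-x)$ for all $x\in[0,1]$. *)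

theory Defs
  imports "HOL-Analysis.Analysis"
begin

definition a_h :: "real \<Rightarrow> real \<Rightarrow> real" where
  "a_h h x = (if (1 - h) / 2 < x \<and> x < (1 + h) / 2 then 0 else 1)"

text \<open>Solution of  -u'' = lambda u + a_h(x) u^p  in (0,1), u(0)=u(1)=0:
  u is C^1 on [0,1] (one-sided derivatives at the endpoints), and u' is
  differentiable (hence u is C^2) on each open interval where a_h is constant,
  with the equation holding there; i.e. C^2 pieces glued in a C^1 way.\<close>
definition is_solution :: "real \<Rightarrow> real \<Rightarrow> real \<Rightarrow> (real \<Rightarrow> real) \<Rightarrow> bool" where
  "is_solution p h lam u \<longleftrightarrow>
     (\<exists>u'. (\<forall>x\<in>{0..1}. (u has_real_derivative u' x) (at x within {0..1}))
        \<and> continuous_on {0..1} u'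
        \<and> (\<forall>x\<in>{0<..<1} - {(1 - h) / 2, (1 + h) / 2}.
             (u' has_real_derivative (- (lam * u x + a_h h x * u x powr p))) (at x)))
     \<and> u 0 = 0 \<and> u 1 = 0"

definition is_positive_solution :: "real \<Rightarrow> real \<Rightarrow> real \<Rightarrow> (real \<Rightarrow> real) \<Rightarrow> bool" where
  "is_positive_solution p h lam u \<longleftrightarrow> is_solution p h lam u \<and> (\<forall>x\<in>{0<..<1}. u x > 0)"

definition is_symmetric :: "(real \<Rightarrow> real) \<Rightarrow> bool" where
  "is_symmetric u \<longleftrightarrow> (\<forall>x\<in>{0..1}. u x = u (1 - x))"

end

(*  A solution is studied on the left interval [0, L], L = (1 - h)/2, where the energy identity holds;
    by symmetry the linear equation on the middle interval prescribes the quotient u'/u at L.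

    Uniqueness: if two such arcs had different initial slopes, their Wronskian would vanish at L and
    hence have a first zero in (0, L], which the energy identity forbids.

    Existence: w = u'/u is strictly decreasing along an arc, and on a fixed energy level u is an
    explicit function of w. So the time w needs to come down from infinity to the prescribed value
    is the integral of a positive function over a half-line, without singularities at the turning
    point of u. It depends continuously on the level, is short for large levels, and for small ones
    it approaches the time of the linear flow, which exceeds L exactly when lam < pi^2. The level
    with passage time L is inverted to produce the solution.

    Nonexistence: the Wronskian with sin (pi x) is monotone, strictly so on [0, L], and vanishes at
    both ends. *)

theory Submission
  imports Defs
begin

subsection \<open>Uniqueness and nonexistence\<close>

text \<open>Positivity includes the right endpoint, so that the quotient \<open>u' / u\<close> makes
  sense at \<open>L\<close>, where the arc meets the middle piece.\<close>

definition positive_arc :: "real \<Rightarrow> real \<Rightarrow> real \<Rightarrow> (real \<Rightarrow> real) \<Rightarrow> (real \<Rightarrow> real) \<Rightarrow> bool" where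
  "positive_arc p lam L u u' \<longleftrightarrow>
     (\<forall>x\<in>{0..L}. (u has_real_derivative u' x) (at x within {0..L}))
     \<and> continuous_on {0..L} u'
     \<and> (\<forall>x\<in>{0<..<L}. (u' has_real_derivative - (lam * u x + u x powr p)) (at x))
     \<and> u 0 = 0 \<and> (\<forall>x\<in>{0<..L}. u x > 0)"

lemma positive_arcD:
  assumes "positive_arc p lam L u u'"
  shows "\<And>x. 0 \<le> x \<Longrightarrow> x \<le> L \<Longrightarrow> (u has_real_derivative u' x) (at x within {0..L})"
    and "\<And>x. 0 < x \<Longrightarrow> x < L \<Longrightarrow> (u has_real_derivative u' x) (at x)"
    and "continuous_on {0..L} u" and "continuous_on {0..L} u'"
    and "\<And>x. 0 < x \<Longrightarrow> x < L \<Longrightarrow> (u' has_real_derivative - (lam * u x + u x powr p)) (at x)"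
    and "u 0 = 0" and "\<And>x. 0 < x \<Longrightarrow> x \<le> L \<Longrightarrow> u x > 0"
proof -
  show d: "(u has_real_derivative u' x) (at x within {0..L})" if "0 \<le> x" "x \<le> L" for x
    using assms that by (auto simp: positive_arc_def)
  show "(u has_real_derivative u' x) (at x)" if "0 < x" "x < L" for x
    using d[of x] that by (simp add: at_within_Icc_at)
  show "continuous_on {0..L} u"
    by (rule DERIV_continuous_on) (use d in auto)
qed (use assms in \<open>auto simp: positive_arc_def\<close>)

text \<open>Multiplying the equation by \<open>2 * u'\<close> shows that the left-hand side has
  derivative zero; since \<open>u 0 = 0\<close>, only the slope survives at the start.\<close>

lemma positive_arc_energy:
  assumes "positive_arc p lam L u u'" and "p > 1" and "0 < x" and "x \<le> L"
  shows "(u' x)\<^sup>2 + lam * (u x)\<^sup>2 + 2 / (p + 1) * u x powr (p + 1) = (u' 0)\<^sup>2"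
proof -
  note A = positive_arcD[OF assms(1)]
  define E where "E x = (u' x)\<^sup>2 + lam * (u x)\<^sup>2 + 2 / (p + 1) * u x powr (p + 1)" for x
  have sub: "{0..x} \<subseteq> {0..L}" using assms by auto
  have pos: "u y \<ge> 0" if "y \<in> {0..x}" for y
    using A(6) A(7)[of y] that assms(4) by (cases "y = 0") (auto simp: less_imp_le)
  have "continuous_on {0..x} (\<lambda>x. u x powr (p + 1))"
    by (rule continuous_on_powr'[OF continuous_on_subset[OF A(3) sub] continuous_on_const])
       (use assms(2) pos in auto)
  then have cont: "continuous_on {0..x} E"
    unfolding E_def
    by (intro continuous_on_add continuous_on_mult continuous_on_power continuous_on_const
        continuous_on_subset[OF A(3) sub] continuous_on_subset[OF A(4) sub])
  have "DERIV E y :> 0" if "0 < y" "y < x" for y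
  proof -
    have y: "y < L" "0 < u y" using that assms A(7)[of y] by auto
    have "u y powr (p + 1) = u y * u y powr p"
      using y by (simp add: powr_add)
    moreover have "DERIV (\<lambda>y. u y powr (p + 1)) y :> (p + 1) * u y powr p * u' y"
      using DERIV_fun_powr[OF A(2)[OF that(1) y(1)] y(2), of "p + 1"] by simp
    ultimately show ?thesis
      unfolding E_def using assms(2) y that
      by (auto intro!: derivative_eq_intros A(2) A(5) simp: field_simps power2_eq_square)
  qed
  then have "E x = E 0"
    using DERIV_isconst_end[OF assms(3) cont] by auto
  then show ?thesis
    using assms(2) A(6) by (simp add: E_def)
qed

text \<open>A negative slope would push \<open>u\<close> below zero just after \<open>0\<close>. The
  sign matters because the energy identity sees only the square of the slope.\<close>

lemma positive_arc_slope_nonneg: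
  assumes "positive_arc p lam L u u'" and "0 < L"
  shows "u' 0 \<ge> 0"
proof (rule ccontr)
  note A = positive_arcD[OF assms(1)]
  assume "\<not> u' 0 \<ge> 0"
  then obtain d where d: "d > 0" "\<And>h. h > 0 \<Longrightarrow> 0 + h \<in> {0..L} \<Longrightarrow> h < d \<Longrightarrow> u (0 + h) < u 0"
    using has_real_derivative_neg_dec_right[OF A(1)[of 0]] assms(2) by (auto simp: not_le)
  define h where "h = min (d / 2) L"
  have "h > 0" "h \<le> L" "h < d" using d(1) assms(2) by (auto simp: h_def)
  then show False using d(2)[of h] A(7)[of h] A(6) by auto
qed

section \<open>Comparison of two arcs\<close>

text \<open>The terms with \<open>lam\<close> cancel, so the sign of the derivative is decided by
  the order of \<open>u x\<close> and \<open>v x\<close> alone.\<close>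

lemma wronskian_derivative:
  assumes "positive_arc p lam L u u'" and "positive_arc p lam L v v'" and "0 < x" and "x < L"
  shows "((\<lambda>x. u' x * v x - v' x * u x) has_real_derivative
           u x * v x * (v x powr (p - 1) - u x powr (p - 1))) (at x)"
proof -
  note A = positive_arcD[OF assms(1)] and B = positive_arcD[OF assms(2)]
  have p: "u x powr p = u x * u x powr (p - 1)" "v x powr p = v x * v x powr (p - 1)"
    using A(7)[of x] B(7)[of x] assms
    by (simp_all add: powr_mult_base)
  show ?thesis
    using assms by (auto intro!: derivative_eq_intros A(2) A(5) B(2) B(5) simp: p algebra_simps)
qed

text \<open>At a zero of the Wronskian both arcs have the same quotient \<open>u' / u\<close>, and the energy identity
  then orders their values there in the same way as their initial slopes, so the Wronskian
  was increasing just before: it cannot have come down to its first zero.\<close>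
lemma wronskian_positive:
  assumes u: "positive_arc p lam L u u'" and v: "positive_arc p lam L v v'"
    and p: "p > 1" and "0 < L" and slopes: "u' 0 < v' 0"
  shows "u' L * v L - v' L * u L > 0"
proof (rule ccontr)
  note A = positive_arcD[OF u] and B = positive_arcD[OF v]
  define N where "N x = u' x * v x - v' x * u x" for x
  assume "\<not> ?thesis"
  then have NL: "N L \<le> 0" by (simp add: N_def)
  have contN: "continuous_on {0..L} N"
    unfolding N_def by (intro continuous_intros A B)
  have dN: "DERIV N x :> u x * v x * (v x powr (p - 1) - u x powr (p - 1))" if "0 < x" "x < L" for x
    unfolding N_def using wronskian_derivative[OF u v that] .
  have pw: "u x * v x * (v x powr (p - 1) - u x powr (p - 1)) > 0"
    if "0 < x" "x \<le> L" "u x < v x" for x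
    using A(7)[of x] that p powr_less_mono2[of "p - 1" "u x" "v x"] by simp
  have inc: "N a < N b" if "0 \<le> a" "a < b" "b \<le> L" "\<And>x. a < x \<Longrightarrow> x < b \<Longrightarrow> u x < v x" for a b
  proof (rule DERIV_pos_imp_increasing_open[OF that(2)])
    fix x assume "a < x" "x < b"
    then show "\<exists>y. DERIV N x :> y \<and> y > 0"
      using dN[of x] pw[of x] that by auto
  next
    show "continuous_on {a..b} N"
      using that by (intro continuous_on_subset[OF contN]) auto
  qed
  \<comment> \<open>The steeper arc \<open>v\<close> starts out above \<open>u\<close>, so
    \<open>N\<close> leaves its zero at \<open>0\<close> upwards; \<open>e\<close> then separates
    this zero from any later one.\<close>
  have "((\<lambda>x. v x - u x) has_real_derivative v' 0 - u' 0) (at 0 within {0..L})"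
    using A(1)[of 0] B(1)[of 0] \<open>0 < L\<close> by (intro DERIV_diff) auto
  from has_real_derivative_pos_inc_right[OF this] slopes
  obtain d where d: "d > 0" "\<And>h. h > 0 \<Longrightarrow> h \<le> L \<Longrightarrow> h < d \<Longrightarrow> u h < v h"
    using A(6) B(6) by auto
  define e where "e = min (d / 2) L"
  have e: "0 < e" "e \<le> L" "e < d" using d(1) \<open>0 < L\<close> by (auto simp: e_def)
  have Npos: "N x > 0" if "0 < x" "x \<le> e" for x
  proof -
    have "N 0 < N x" by (rule inc) (use that e d(2) in auto)
    then show ?thesis using A(6) B(6) by (simp add: N_def)
  qed
  \<comment> \<open>The least element of this compact set is the first zero of \<open>N\<close> in
    \<open>{0<..L}\<close>.\<close>
  define S where "S = {e..L} \<inter> N -` {..0}"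
  have "closed S"
    unfolding S_def
    by (rule continuous_closed_preimage) (use e in \<open>auto intro: continuous_on_subset[OF contN]\<close>)
  then have "compact S"
    using compact_Int_closed[of "{e..L}" S] by (simp add: S_def Int_absorb1 inf.assoc[symmetric])
  moreover have "L \<in> S" using NL e by (auto simp: S_def)
  ultimately obtain x1 where x1: "x1 \<in> S" "\<And>x. x \<in> S \<Longrightarrow> x1 \<le> x"
    using compact_attains_inf[of S] by auto
  have x1': "e < x1" "x1 \<le> L" "N x1 \<le> 0"
    using x1(1) Npos[of e] e by (auto simp: S_def le_less)
  have left: "N x > 0" if "0 < x" "x < x1" for x
  proof (rule ccontr)
    assume "\<not> N x > 0"
    then have "x \<in> S" using Npos[of x] that x1' by (cases "x \<le> e") (auto simp: S_def)
    then show False using x1(2) that by fastforce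
  qed
  have pos: "u x1 > 0" "v x1 > 0" using A(7)[of x1] B(7)[of x1] x1' e by auto
  have "N x1 \<ge> 0"
  proof (rule ccontr)
    assume "\<not> N x1 \<ge> 0"
    moreover have "continuous_on {e..x1} N"
      by (rule continuous_on_subset[OF contN]) (use e x1' in auto)
    ultimately obtain x where "e \<le> x" "x \<le> x1" "N x = N x1 / 2"
      using IVT2'[of N x1 "N x1 / 2" e] Npos[of e] e x1' by force
    with \<open>\<not> N x1 \<ge> 0\<close> show False using left[of x] e by (cases "x = x1") auto
  qed
  then have "N x1 = 0" using x1' by simp
  then have w: "u' x1 / u x1 = v' x1 / v x1"
    using pos by (simp add: N_def field_simps)
  \<comment> \<open>The energy identity with the square of \<open>z x1\<close> factored out: by
    \<open>w\<close> the two arcs share the quotient \<open>z' x1 / z x1\<close>, so the right-hand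
    sides differ only through the values at \<open>x1\<close>.\<close>
  have en: "(z' 0)\<^sup>2 = (z x1)\<^sup>2 * ((z' x1 / z x1)\<^sup>2 + lam + 2 / (p + 1) * z x1 powr (p - 1))"
    if z: "positive_arc p lam L z z'" and "z x1 > 0" for z z'
  proof -
    have "z x1 powr (p + 1) = (z x1)\<^sup>2 * z x1 powr (p - 1)"
      using that(2) by (simp add: powr_diff powr_add power2_eq_square field_simps)
    then show ?thesis
      using positive_arc_energy[OF z p, of x1] x1' e that(2) by (simp add: field_simps)
  qed
  have "u x1 < v x1"
  proof (rule ccontr)
    assume "\<not> u x1 < v x1"
    then have le: "v x1 \<le> u x1" by simp
    define W where "W = (u' x1 / u x1)\<^sup>2 + lam"
    have eu: "(u' 0)\<^sup>2 = (u x1)\<^sup>2 * (W + 2 / (p + 1) * u x1 powr (p - 1))"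
      using en[OF u pos(1)] by (simp add: W_def)
    have ev: "(v' 0)\<^sup>2 = (v x1)\<^sup>2 * (W + 2 / (p + 1) * v x1 powr (p - 1))"
      using en[OF v pos(2)] by (simp add: W_def w)
    have "W + 2 / (p + 1) * v x1 powr (p - 1) \<le> W + 2 / (p + 1) * u x1 powr (p - 1)"
      using le pos p by (auto intro!: add_left_mono mult_left_mono powr_mono2 divide_right_mono)
    \<comment> \<open>As \<open>lam\<close> may be negative, this is not obvious; by
      \<open>ev\<close> the bracket times a positive square is itself a square.\<close>
    moreover have "W + 2 / (p + 1) * v x1 powr (p - 1) \<ge> 0"
      using ev pos by (metis zero_le_mult_iff zero_le_power2 zero_less_power2 not_le less_imp_neq)
    moreover have "(v x1)\<^sup>2 \<le> (u x1)\<^sup>2" using le pos by (simp add: power_mono)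
    ultimately have "(v' 0)\<^sup>2 \<le> (u' 0)\<^sup>2"
      unfolding eu ev by (intro mult_mono) auto
    moreover have "u' 0 \<ge> 0" using positive_arc_slope_nonneg[OF u \<open>0 < L\<close>] .
    ultimately show False using slopes by (simp add: abs_le_square_iff[symmetric])
  qed
  have "\<exists>a. e \<le> a \<and> a < x1 \<and> (\<forall>x. a < x \<and> x < x1 \<longrightarrow> u x < v x)"
  proof -
    have "continuous_on {e..x1} (\<lambda>x. v x - u x)"
      by (intro continuous_intros continuous_on_subset[OF A(3)] continuous_on_subset[OF B(3)])
         (use e x1' in auto)
    then obtain r where r: "r > 0" "\<And>x. x \<in> {e..x1} \<Longrightarrow> dist x x1 < r \<Longrightarrow> dist (v x - u x) (v x1 - u x1) < v x1 - u x1"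
      using \<open>u x1 < v x1\<close> x1' unfolding continuous_on_iff by (metis atLeastAtMost_iff diff_gt_0_iff_gt less_imp_le order_refl)
    have "u x < v x" if "max e (x1 - r) < x" "x < x1" for x
      using r(2)[of x] that by (auto simp: dist_real_def)
    then show ?thesis using r(1) x1' by (intro exI[of _ "max e (x1 - r)"]) auto
  qed
  then obtain a where a: "e \<le> a" "a < x1" "\<And>x. a < x \<Longrightarrow> x < x1 \<Longrightarrow> u x < v x" by blast
  have "N a < N x1" by (rule inc) (use a e x1' in auto)
  then show False using left[of a] a e x1' by auto
qed

text \<open>The case of equal initial slopes is the Lipschitz estimate behind uniqueness for the Cauchy
  problem: \<open>(u - v)\<^sup>2 + (u' - v')\<^sup>2\<close> grows at most exponentially.\<close>
lemma positive_arc_eqI: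
  assumes u: "positive_arc p lam L u u'" and v: "positive_arc p lam L v v'"
    and p: "p > 1" and slopes: "u' 0 = v' 0" and x: "0 \<le> x" "x \<le> L"
  shows "u x = v x" and "u' x = v' x"
proof -
  note A = positive_arcD[OF u] and B = positive_arcD[OF v]
  have "compact (u ` {0..L} \<union> v ` {0..L})"
    by (intro compact_Un compact_continuous_image A B compact_Icc)
  then obtain M where M0: "M > 0" and M: "\<And>z. z \<in> u ` {0..L} \<union> v ` {0..L} \<Longrightarrow> norm z \<le> M"
    using compact_imp_bounded bounded_pos by metis
  define C where "C = p * M powr (p - 1)"
  \<comment> \<open>The power is Lipschitz on the common bounded range, because \<open>p > 1\<close>
    keeps its derivative below \<open>C\<close> down to zero.\<close>
  have lip1: "\<bar>b powr p - a powr p\<bar> \<le> C * \<bar>b - a\<bar>" if ab: "0 < a" "a < b" "b \<le> M" for a b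
  proof -
    have "\<exists>z. a < z \<and> z < b \<and> b powr p - a powr p = (b - a) * (p * z powr (p - 1))"
      using ab by (intro MVT2) (auto intro!: derivative_eq_intros)
    then obtain z where z: "a < z" "z < b" "b powr p - a powr p = (b - a) * (p * z powr (p - 1))" by auto
    have "z powr (p - 1) \<le> M powr (p - 1)" using z ab p by (intro powr_mono2) auto
    then show ?thesis using z ab p by (simp add: C_def abs_mult mult.commute mult_left_mono)
  qed
  have lip: "\<bar>b powr p - a powr p\<bar> \<le> C * \<bar>b - a\<bar>" if ab: "0 < a" "a \<le> M" "0 < b" "b \<le> M" for a b
    using lip1[of a b] lip1[of b a] ab by (cases a b rule: linorder_cases) (auto simp: abs_minus_commute)
  have C0: "C \<ge> 0" using p by (simp add: C_def)
  \<comment> \<open>The three summands bound the coefficients of \<open>d\<close> coming from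
    \<open>2 * d * e\<close>, from the linear term and from the power.\<close>
  define k where "k = 1 + \<bar>lam\<bar> + C"
  define F where "F x = (u x - v x)\<^sup>2 + (u' x - v' x)\<^sup>2" for x
  define H where "H x = F x * exp (- k * x)" for x
  have "H x \<le> H 0"
  proof (rule DERIV_nonpos_imp_decreasing_open[of 0 x H])
    show "continuous_on {0..x} H"
      unfolding H_def F_def using x
      by (intro continuous_intros continuous_on_subset[OF A(3)] continuous_on_subset[OF A(4)]
          continuous_on_subset[OF B(3)] continuous_on_subset[OF B(4)]) auto
    fix y assume "0 < y" "y < x"
    then have y: "0 < y" "y < L" using x by auto
    define d e q where "d = u y - v y" and "e = u' y - v' y" and "q = u y powr p - v y powr p"
    have dF: "DERIV F y :> 2 * d * e + 2 * e * (- (lam * d + q))"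
      unfolding F_def using y
      by (auto intro!: derivative_eq_intros A(2) A(5) B(2) B(5) simp: d_def e_def q_def algebra_simps)
    have "\<bar>q\<bar> \<le> C * \<bar>d\<bar>"
      unfolding q_def d_def using M[of "u y"] M[of "v y"] A(7)[of y] B(7)[of y] y
      by (intro lip) auto
    moreover have "\<bar>lam * d\<bar> = \<bar>lam\<bar> * \<bar>d\<bar>" by (simp add: abs_mult)
    ultimately have "\<bar>d - (lam * d + q)\<bar> \<le> k * \<bar>d\<bar>"
      by (simp add: k_def algebra_simps) linarith
    then have "\<bar>e\<bar> * \<bar>d - (lam * d + q)\<bar> \<le> \<bar>e\<bar> * (k * \<bar>d\<bar>)"
      by (intro mult_left_mono) auto
    then have "e * (d - (lam * d + q)) \<le> k * (\<bar>e\<bar> * \<bar>d\<bar>)"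
      by (simp add: abs_mult[symmetric] mult.left_commute)
    moreover have "2 * (\<bar>e\<bar> * \<bar>d\<bar>) \<le> d\<^sup>2 + e\<^sup>2"
      using sum_squares_bound[of "\<bar>e\<bar>" "\<bar>d\<bar>"] by simp
    then have "k * (2 * (\<bar>e\<bar> * \<bar>d\<bar>)) \<le> k * (d\<^sup>2 + e\<^sup>2)"
      using C0 by (intro mult_left_mono) (auto simp: k_def)
    ultimately have "2 * d * e + 2 * e * (- (lam * d + q)) \<le> k * F y"
      by (simp add: F_def d_def[symmetric] e_def[symmetric] algebra_simps)
    then have "(2 * d * e + 2 * e * (- (lam * d + q)) - k * F y) * exp (- k * y) \<le> 0"
      by (intro mult_nonpos_nonneg) auto
    moreover have "DERIV H y :> (2 * d * e + 2 * e * (- (lam * d + q)) - k * F y) * exp (- k * y)"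
      unfolding H_def by (auto intro!: derivative_eq_intros dF simp: algebra_simps)
    ultimately show "\<exists>z. DERIV H y :> z \<and> z \<le> 0" by blast
  qed (use x in auto)
  moreover have "H 0 = 0" using A(6) B(6) slopes by (simp add: H_def F_def)
  ultimately have "F x \<le> 0" by (simp add: H_def mult_le_0_iff)
  then show "u x = v x" "u' x = v' x" by (simp_all add: F_def sum_power2_le_zero_iff)
qed

section \<open>Nonexistence and uniqueness on the whole interval\<close>

text \<open>Splitting at \<open>L\<close> and \<open>1 - L\<close> removes \<open>a_h\<close> from
  the nonexistence and uniqueness arguments.\<close>

lemma positive_solutionE:
  assumes "is_positive_solution p h lam u" and "0 < h" and "h < 1" and L_def: "L = (1 - h) / 2"
  obtains u' where "\<And>x. 0 \<le> x \<Longrightarrow> x \<le> 1 \<Longrightarrow> (u has_real_derivative u' x) (at x within {0..1})"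
    and "\<And>x. 0 < x \<Longrightarrow> x < 1 \<Longrightarrow> (u has_real_derivative u' x) (at x)"
    and "continuous_on {0..1} u" and "continuous_on {0..1} u'"
    and "positive_arc p lam L u u'"
    and "\<And>x. L < x \<Longrightarrow> x < 1 - L \<Longrightarrow> (u' has_real_derivative - (lam * u x)) (at x)"
    and "\<And>x. 1 - L < x \<Longrightarrow> x < 1 \<Longrightarrow> (u' has_real_derivative - (lam * u x + u x powr p)) (at x)"
    and "u 0 = 0" and "u 1 = 0" and "\<And>x. 0 < x \<Longrightarrow> x < 1 \<Longrightarrow> u x > 0"
proof -
  from assms(1) obtain u' where
    d: "\<forall>x\<in>{0..1}. (u has_real_derivative u' x) (at x within {0..1})"
    and c: "continuous_on {0..1} u'"
    and dd: "\<forall>x\<in>{0<..<1} - {(1 - h) / 2, (1 + h) / 2}.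
        (u' has_real_derivative - (lam * u x + a_h h x * u x powr p)) (at x)"
    and bc: "u 0 = 0" "u 1 = 0" and pos: "\<forall>x\<in>{0<..<1}. u x > 0"
    unfolding is_positive_solution_def is_solution_def by blast
  have R: "(1 + h) / 2 = 1 - L" and R': "(1 - h) / 2 = L" and L: "0 < L" "L < 1 / 2"
    using assms by (auto simp: L_def field_simps)
  note d = d[rule_format] and dd = dd[unfolded R R', rule_format]
  have a: "a_h h x = (if L < x \<and> x < 1 - L then 0 else 1)" for x
    unfolding a_h_def R R' ..
  show ?thesis
  proof (rule that)
    show "(u has_real_derivative u' x) (at x)" if "0 < x" "x < 1" for x
      using d[of x] that by (simp add: at_within_Icc_at)
    show "continuous_on {0..1} u" by (rule DERIV_continuous_on) (use d in auto)
    have "(u has_real_derivative u' x) (at x within {0..L})" if "x \<in> {0..L}" for x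
      by (rule DERIV_subset[OF d]) (use that L in auto)
    moreover have "(u' has_real_derivative - (lam * u x + u x powr p)) (at x)" if "x \<in> {0<..<L}" for x
      using dd[of x] that L by (simp add: a R)
    ultimately show "positive_arc p lam L u u'"
      using continuous_on_subset[OF c, of "{0..L}"] L bc pos by (auto simp: positive_arc_def)
    show "(u' has_real_derivative - (lam * u x)) (at x)" if "L < x" "x < 1 - L" for x
      using dd[of x] that L by (simp add: a R)
    show "(u' has_real_derivative - (lam * u x + u x powr p)) (at x)" if "1 - L < x" "x < 1" for x
      using dd[of x] that L by (simp add: a R)
  qed (use d c bc pos in auto)
qed

text \<open>Testing against the first eigenfunction \<open>sin (pi * x)\<close>: for
  \<open>lam\<close> at least \<open>pi\<^sup>2\<close> no term in the derivative of the Wronskian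
  \<open>D\<close> is positive, yet \<open>D\<close> has equal values at \<open>0\<close> and
  \<open>1\<close>.\<close>

lemma positive_solution_lam_less:
  assumes "is_positive_solution p h lam u" and h: "0 < h" "h < 1"
  shows "lam < pi\<^sup>2"
proof (rule ccontr)
  assume "\<not> lam < pi\<^sup>2"
  then have lam: "pi\<^sup>2 \<le> lam" by simp
  define L where "L = (1 - h) / 2"
  have L: "0 < L" "L < 1 / 2" using h by (auto simp: L_def field_simps)
  obtain u' where dw: "\<And>x. 0 \<le> x \<Longrightarrow> x \<le> 1 \<Longrightarrow> (u has_real_derivative u' x) (at x within {0..1})"
    and d: "\<And>x. 0 < x \<Longrightarrow> x < 1 \<Longrightarrow> (u has_real_derivative u' x) (at x)"
    and c: "continuous_on {0..1} u" "continuous_on {0..1} u'"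
    and arc: "positive_arc p lam L u u'"
    and mid: "\<And>x. L < x \<Longrightarrow> x < 1 - L \<Longrightarrow> (u' has_real_derivative - (lam * u x)) (at x)"
    and right: "\<And>x. 1 - L < x \<Longrightarrow> x < 1 \<Longrightarrow> (u' has_real_derivative - (lam * u x + u x powr p)) (at x)"
    and bc: "u 0 = 0" "u 1 = 0" and pos: "\<And>x. 0 < x \<Longrightarrow> x < 1 \<Longrightarrow> u x > 0"
  proof (rule positive_solutionE[OF assms L_def], goal_cases)
    case 1
    from 1(2-) show ?thesis by (rule 1(1))
  qed
  define D where "D x = u' x * sin (pi * x) - pi * u x * cos (pi * x)" for x
  have cD: "continuous_on {a..b} D" if "0 \<le> a" "b \<le> 1" for a b
    unfolding D_def using that
    by (intro continuous_intros continuous_on_subset[OF c(1)] continuous_on_subset[OF c(2)]) auto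
  have sn: "sin (pi * x) > 0" if "0 < x" "x < 1" for x
    using that by (intro sin_gt_zero) auto
  \<comment> \<open>Here \<open>g\<close> stands for the nonlinear term: \<open>u x powr p\<close>
    on the outer intervals and \<open>0\<close> on the middle one.\<close>
  have dD: "DERIV D x :> - ((lam - pi\<^sup>2) * u x + g) * sin (pi * x)"
    if "0 < x" "x < 1" "DERIV u' x :> - (lam * u x + g)" for x g
    unfolding D_def
    by (auto intro!: derivative_eq_intros d that simp: algebra_simps power2_eq_square)
  have le: "- ((lam - pi\<^sup>2) * u x + g) * sin (pi * x) \<le> 0" if "0 < x" "x < 1" "g \<ge> 0" for x g
  proof -
    have "(lam - pi\<^sup>2) * u x \<ge> 0" using lam pos[of x] that by simp
    then show ?thesis using sn[of x] that by (intro mult_nonpos_nonneg) auto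
  qed
  have "D L < D 0"
  proof (rule DERIV_neg_imp_decreasing_open[of 0 L D])
    fix x assume x: "0 < x" "x < L"
    have "- ((lam - pi\<^sup>2) * u x + u x powr p) * sin (pi * x) < 0"
    proof -
      \<comment> \<open>Strictness has to come from the power, since the linear term vanishes for
        \<open>lam = pi\<^sup>2\<close>.\<close>
      have "(lam - pi\<^sup>2) * u x + u x powr p > 0"
        using lam pos[of x] x L by (intro add_nonneg_pos) auto
      then show ?thesis using sn[of x] x L by (intro mult_neg_pos) auto
    qed
    moreover have "DERIV D x :> - ((lam - pi\<^sup>2) * u x + u x powr p) * sin (pi * x)"
      using x L by (intro dD positive_arcD(5)[OF arc]) auto
    ultimately show "\<exists>y. DERIV D x :> y \<and> y < 0" by blast
  qed (use L cD in auto)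
  moreover have "D (1 - L) \<le> D L"
  proof (rule DERIV_nonpos_imp_decreasing_open[of L "1 - L" D])
    fix x assume x: "L < x" "x < 1 - L"
    have "DERIV D x :> - ((lam - pi\<^sup>2) * u x + 0) * sin (pi * x)"
      using x L mid[OF x] by (intro dD) auto
    with le[of x 0] x L show "\<exists>y. DERIV D x :> y \<and> y \<le> 0" by fastforce
  qed (use L cD in auto)
  moreover have "D 1 \<le> D (1 - L)"
  proof (rule DERIV_nonpos_imp_decreasing_open[of "1 - L" 1 D])
    fix x assume x: "1 - L < x" "x < 1"
    have "DERIV D x :> - ((lam - pi\<^sup>2) * u x + u x powr p) * sin (pi * x)"
      using x L by (intro dD right) auto
    with le[of x "u x powr p"] x L show "\<exists>y. DERIV D x :> y \<and> y \<le> 0" by auto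
  qed (use L cD in auto)
  ultimately show False using bc by (simp add: D_def)
qed

text \<open>Symmetry makes both derivatives vanish at \<open>1 / 2\<close>, which annihilates the
  Wronskian there and, the middle equation being linear, back to \<open>L\<close>. The comparison of
  arcs then forces equal initial slopes, and equality spreads from the left interval to the middle
  and by reflection to the right.\<close>

lemma symmetric_positive_solution_unique:
  assumes u: "is_positive_solution p h lam u" "is_symmetric u"
    and v: "is_positive_solution p h lam v" "is_symmetric v"
    and p: "p > 1" and h: "0 < h" "h < 1" and x: "x \<in> {0..1}"
  shows "u x = v x"
proof -
  define L where "L = (1 - h) / 2"
  have L: "0 < L" "L < 1 / 2" using h by (auto simp: L_def field_simps)
  obtain u' where dwu: "\<And>x. 0 \<le> x \<Longrightarrow> x \<le> 1 \<Longrightarrow> (u has_real_derivative u' x) (at x within {0..1})"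
    and du: "\<And>x. 0 < x \<Longrightarrow> x < 1 \<Longrightarrow> (u has_real_derivative u' x) (at x)"
    and cu: "continuous_on {0..1} u" "continuous_on {0..1} u'"
    and arcu: "positive_arc p lam L u u'"
    and midu: "\<And>x. L < x \<Longrightarrow> x < 1 - L \<Longrightarrow> (u' has_real_derivative - (lam * u x)) (at x)"
    and rightu: "\<And>x. 1 - L < x \<Longrightarrow> x < 1 \<Longrightarrow> (u' has_real_derivative - (lam * u x + u x powr p)) (at x)"
    and bcu: "u 0 = 0" "u 1 = 0" and posu: "\<And>x. 0 < x \<Longrightarrow> x < 1 \<Longrightarrow> u x > 0"
  proof (rule positive_solutionE[OF u(1) h L_def], goal_cases)
    case 1
    from 1(2-) show ?thesis by (rule 1(1))
  qed
  obtain v' where dwv: "\<And>x. 0 \<le> x \<Longrightarrow> x \<le> 1 \<Longrightarrow> (v has_real_derivative v' x) (at x within {0..1})"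
    and dv: "\<And>x. 0 < x \<Longrightarrow> x < 1 \<Longrightarrow> (v has_real_derivative v' x) (at x)"
    and cv: "continuous_on {0..1} v" "continuous_on {0..1} v'"
    and arcv: "positive_arc p lam L v v'"
    and midv: "\<And>x. L < x \<Longrightarrow> x < 1 - L \<Longrightarrow> (v' has_real_derivative - (lam * v x)) (at x)"
    and rightv: "\<And>x. 1 - L < x \<Longrightarrow> x < 1 \<Longrightarrow> (v' has_real_derivative - (lam * v x + v x powr p)) (at x)"
    and bcv: "v 0 = 0" "v 1 = 0" and posv: "\<And>x. 0 < x \<Longrightarrow> x < 1 \<Longrightarrow> v x > 0"
  proof (rule positive_solutionE[OF v(1) h L_def], goal_cases)
    case 1
    from 1(2-) show ?thesis by (rule 1(1))
  qed
  have half: "z' (1 / 2) = 0"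
    if z: "is_symmetric z" and dz: "\<And>x. 0 < x \<Longrightarrow> x < 1 \<Longrightarrow> (z has_real_derivative z' x) (at x)"
    for z z' :: "real \<Rightarrow> real"
  proof -
    have "((\<lambda>x. z (1 - x)) has_real_derivative - z' (1 / 2)) (at (1 / 2))"
    proof -
      have "((\<lambda>x. 1 - x) has_real_derivative - 1) (at (1 / 2 :: real))"
        by (auto intro!: derivative_eq_intros)
      then show ?thesis
        using DERIV_chain2[of z "z' (1 / 2)" "\<lambda>x. 1 - x" "1 / 2" "- 1" UNIV] dz[of "1 / 2"] by simp
    qed
    then have flip: "(z has_real_derivative - z' (1 / 2)) (at (1 / 2))"
    proof (rule has_field_derivative_transform_within_open)
      show "open {0<..<1::real}" "1 / 2 \<in> {0<..<1::real}" by auto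
      show "z (1 - x) = z x" if "x \<in> {0<..<1}" for x
        using z[unfolded is_symmetric_def, rule_format, of x] that by simp
    qed
    have "(z has_real_derivative z' (1 / 2)) (at (1 / 2))" by (rule dz) auto
    from DERIV_unique[OF flip this] show ?thesis by simp
  qed
  define N where "N x = u' x * v x - v' x * u x" for x
  have N: "N x = 0" if "L \<le> x" "x \<le> 1 / 2" for x
  proof -
    have "N x = N L" if "L \<le> x" "x \<le> 1 / 2" for x
    proof (rule DERIV_isconst2[of L "1 / 2" N])
      show "continuous_on {L..1 / 2} N"
        unfolding N_def using L
        by (intro continuous_intros continuous_on_subset[OF cu(1)] continuous_on_subset[OF cu(2)]
          continuous_on_subset[OF cv(1)] continuous_on_subset[OF cv(2)]) auto
      show "DERIV N x :> 0" if "L < x" "x < 1 / 2" for x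
      proof -
        have "0 < x" "x < 1" "x < 1 - L" using that L by auto
        then show ?thesis
          unfolding N_def using that by (auto intro!: derivative_eq_intros du dv midu midv)
      qed
    qed (use that L in auto)
    from this[of x] this[of "1 / 2"] show ?thesis
      using that half[OF u(2) du] half[OF v(2) dv] L by (simp add: N_def)
  qed
  have "u' 0 = v' 0"
  proof (cases "u' 0" "v' 0" rule: linorder_cases)
    case less
    then show ?thesis using wronskian_positive[OF arcu arcv p L(1)] N[of L] L by (simp add: N_def)
  next
    case greater
    then show ?thesis using wronskian_positive[OF arcv arcu p L(1)] N[of L] L by (simp add: N_def)
  qed
  then have left: "u x = v x" if "0 \<le> x" "x \<le> L" for x
    using positive_arc_eqI(1)[OF arcu arcv p _ that] by simp
  \<comment> \<open>The vanishing Wronskian is the numerator of the derivative of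
    \<open>u / v\<close>.\<close>
  have ratio: "u x / v x = u L / v L" if "L \<le> x" "x \<le> 1 / 2" for x
  proof (rule DERIV_isconst2[of L "1 / 2" "\<lambda>x. u x / v x"])
    show "continuous_on {L..1 / 2} (\<lambda>x. u x / v x)"
    proof (rule continuous_on_divide)
      show "\<forall>x\<in>{L..1 / 2}. v x \<noteq> 0"
      proof
        fix x assume "x \<in> {L..1 / 2}"
        then show "v x \<noteq> 0" using L posv[of x] by simp
      qed
    qed (use L in \<open>auto intro!: continuous_on_subset[OF cu(1)] continuous_on_subset[OF cv(1)]\<close>)
    show "DERIV (\<lambda>x. u x / v x) x :> 0" if "L < x" "x < 1 / 2" for x
    proof -
      have "DERIV (\<lambda>x. u x / v x) x :> (u' x * v x - u x * v' x) / (v x * v x)"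
        using that L posv[of x] by (intro DERIV_divide du dv) auto
      then show ?thesis using N[of x] that by (simp add: N_def mult.commute)
    qed
  qed (use that L in auto)
  have "u x = v x" if "L \<le> x" "x \<le> 1 / 2" for x
  proof -
    have "v x > 0" "v L > 0" "u L = v L" using posv left that L by auto
    then show ?thesis using ratio[OF that] by simp
  qed
  then have half: "u x = v x" if "0 \<le> x" "x \<le> 1 / 2" for x
    using left[of x] that by (cases "x \<le> L") auto
  show ?thesis
  proof (cases "x \<le> 1 / 2")
    case False
    have "u x = u (1 - x)" "v x = v (1 - x)"
      using u(2) v(2) x unfolding is_symmetric_def by blast+
    then show ?thesis using half[of "1 - x"] False x by simp
  qed (use half x in auto)
qed

subsection \<open>Energy levels and the Riccati equation\<close>

text \<open>On the energy level \<open>\<alpha>\<close> an arc satisfies \<open>(u'/u)\<^sup>2 + lam = \<alpha>\<^sup>2/u\<^sup>2 - 2/(p+1) u\<^sup>p\<^sup>-\<^sup>1\<close>. With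
  \<open>u = \<sigma> exp V\<close>, \<open>\<mu> = \<sigma>\<^sup>p\<^sup>-\<^sup>1\<close> and \<open>\<alpha>\<^sup>2 = \<sigma>\<^sup>p\<^sup>+\<^sup>1\<close> the right-hand side becomes \<open>\<mu>\<close> times the following
  function of \<open>V\<close>, in which no parameter of the problem other than \<open>p\<close> is left.\<close>
definition level :: "real \<Rightarrow> real \<Rightarrow> real" where
  "level p V = exp (- 2 * V) - 2 / (p + 1) * exp ((p - 1) * V)"

text \<open>This recovers \<open>V\<close>, the logarithm of \<open>u / \<sigma>\<close>, from
  \<open>t = (w\<^sup>2 + lam) / mu\<close>. The inverse is a genuine one on all of the reals, as
  \<open>level p\<close> is shown to be a bijection for \<open>p > 1\<close>.\<close>

definition log_height :: "real \<Rightarrow> real \<Rightarrow> real" where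
  "log_height p = inv (level p)"

text \<open>From \<open>w = u' / u\<close> and the equation,
  \<open>- w' = w\<^sup>2 + lam + u powr (p - 1)\<close>; with the substitution for \<open>u\<close>
  this is \<open>mu\<close> times the speed at \<open>t = (w\<^sup>2 + lam) / mu\<close>.\<close>

definition speed :: "real \<Rightarrow> real \<Rightarrow> real" where
  "speed p t = t + exp ((p - 1) * log_height p t)"

text \<open>The Riccati equation for \<open>w = u'/u\<close> on the energy level of \<open>\<mu>\<close> is \<open>w' = - 1 / slowness\<close>.\<close>
definition slowness :: "real \<Rightarrow> real \<Rightarrow> real \<Rightarrow> real \<Rightarrow> real" where
  "slowness p lam mu w = 1 / (mu * speed p ((w\<^sup>2 + lam) / mu))"

locale superlinear_exponent =
  fixes p :: real
  assumes p: "p > 1"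
begin

section \<open>Inverting the level function\<close>

lemma level_deriv:
  "(level p has_real_derivative - 2 * (exp (- 2 * V) + (p - 1) / (p + 1) * exp ((p - 1) * V))) (at V)"
proof -
  define c where "c = 2 / (p + 1)"
  have c: "(p - 1) / (p + 1) = c * (p - 1) / 2" using p by (simp add: c_def field_simps)
  show ?thesis
    unfolding level_def c c_def[symmetric]
    by (auto intro!: derivative_eq_intros simp: algebra_simps)
qed

lemma level_strict_anti: "V < V' \<Longrightarrow> level p V' < level p V"
proof (rule DERIV_neg_imp_decreasing[of V V' "level p"])
  fix x
  have "exp (- 2 * x) + (p - 1) / (p + 1) * exp ((p - 1) * x) > 0"
    using p by (intro add_pos_nonneg) auto
  then show "\<exists>y. (level p has_real_derivative y) (at x) \<and> y < 0"
    using level_deriv[of x] by (intro exI conjI) auto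
qed

lemma inj_level: "inj (level p)"
  by (rule injI) (metis level_strict_anti less_irrefl linorder_cases)

lemma isCont_level: "isCont (level p) V"
  using level_deriv DERIV_isCont by blast

lemma surj_level: "surj (level p)"
proof -
  have "\<exists>V. level p V = y" for y
  proof -
    \<comment> \<open>At \<open>- R\<close> the first exponential is at least
      \<open>1 + 2 * R\<close> and the subtracted term at most \<open>1\<close>.\<close>
    define R where "R = \<bar>y\<bar>"
    have "1 + 2 * R \<le> exp (2 * R)" by (rule exp_ge_add_one_self)
    moreover have "2 / (p + 1) * exp ((p - 1) * (- R)) \<le> 1 * 1"
      using p by (intro mult_mono) (auto simp: R_def mult_nonneg_nonneg)
    moreover have "level p (- R) = exp (2 * R) - 2 / (p + 1) * exp ((p - 1) * (- R))"
      by (simp add: level_def)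
    ultimately have "2 * R \<le> level p (- R)" by linarith
    then have 1: "y \<le> level p (- R)" by (simp add: R_def)
    \<comment> \<open>\<open>S\<close> makes the linear lower bound of the growing exponential,
      \<open>c + c * (p - 1) * S\<close>, exceed \<open>1 - y\<close>.\<close>
    define c S where "c = 2 / (p + 1)" and "S = max 0 ((1 - y) / (c * (p - 1)))"
    have c: "c * (p - 1) > 0" "c > 0" using p by (simp_all add: c_def)
    have "c * (1 + (p - 1) * S) \<le> c * exp ((p - 1) * S)"
      using c by (intro mult_left_mono exp_ge_add_one_self) auto
    moreover have "1 - y \<le> c * (p - 1) * S"
      using c by (auto simp: S_def max_def field_simps)
    moreover have "exp (- 2 * S) \<le> 1" by (simp add: S_def)
    moreover have "level p S = exp (- 2 * S) - c * exp ((p - 1) * S)"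
      by (simp add: level_def c_def)
    moreover have "c * (1 + (p - 1) * S) = c + c * (p - 1) * S"
      by (simp add: algebra_simps)
    ultimately have 2: "level p S \<le> y" using c(2) by linarith
    have "- R \<le> S" by (simp add: R_def S_def)
    then show ?thesis
      using IVT2[of "level p" S y "- R"] 1 2 isCont_level by blast
  qed
  then show ?thesis by (auto simp: surj_def) metis
qed

lemma level_log_height [simp]: "level p (log_height p t) = t"
  unfolding log_height_def by (rule surj_f_inv_f[OF surj_level])

lemma log_height_level [simp]: "log_height p (level p V) = V"
  unfolding log_height_def by (rule inv_f_f[OF inj_level])

text \<open>Inserting \<open>t = level p V\<close> leaves positive terms only, so the speed stays
  positive also for negative \<open>t\<close>. The sum is moreover minus half the derivative of
  \<open>level p\<close> at \<open>V\<close>.\<close>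

lemma speed_eq:
  "speed p t = exp (- 2 * log_height p t) + (p - 1) / (p + 1) * exp ((p - 1) * log_height p t)"
proof -
  define c where "c = 2 / (p + 1)"
  have c: "(p - 1) / (p + 1) = 1 - c" using p by (simp add: c_def field_simps)
  define E e where "E = exp (- 2 * log_height p t)" and "e = exp ((p - 1) * log_height p t)"
  have "E - c * e = t"
    using level_log_height[of t] unfolding level_def c_def E_def e_def by simp
  then have "t + e = E + (1 - c) * e" by (simp add: left_diff_distrib)
  then show ?thesis unfolding speed_def c E_def e_def .
qed

text \<open>Whatever the sign of \<open>log_height p t\<close>, one of the two exponentials in
  \<open>speed_eq\<close> is at least \<open>1\<close>.\<close>

lemma speed_ge: "speed p t \<ge> (p - 1) / (p + 1)"
proof -
  define V q where "V = log_height p t" and "q = (p - 1) / (p + 1)"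
  have q: "0 < q" "q \<le> 1" using p by (auto simp: q_def)
  have "q \<le> exp (- 2 * V) + q * exp ((p - 1) * V)"
  proof (cases "V \<ge> 0")
    case True
    then have "1 \<le> exp ((p - 1) * V)" using p by simp
    then have "q * 1 \<le> q * exp ((p - 1) * V)" using q by (intro mult_left_mono) auto
    moreover have "exp (- 2 * V) > 0" by (rule exp_gt_zero)
    ultimately show ?thesis by linarith
  next
    case False
    then have "1 \<le> exp (- 2 * V)" by simp
    moreover have "q * exp ((p - 1) * V) > 0" using q by simp
    ultimately show ?thesis using q by linarith
  qed
  then show ?thesis by (simp only: speed_eq V_def q_def)
qed

lemma speed_pos: "speed p t > 0"
  using p by (intro less_le_trans[OF _ speed_ge]) simp

lemma speed_nonzero [simp]: "speed p t \<noteq> 0"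
  using speed_pos[of t] by simp

lemma log_height_deriv: "(log_height p has_real_derivative - 1 / (2 * speed p t)) (at t)"
proof -
  have "(log_height p has_derivative (*) (- 1 / (2 * speed p t))) (at (level p (log_height p t)))"
  proof (rule has_derivative_inverse_strong[where f = "level p" and x = "log_height p t" and S = UNIV])
    show "continuous_on UNIV (level p)"
      using isCont_level by (simp add: continuous_at_imp_continuous_on)
    show "(level p has_derivative (*) (- 2 * speed p t)) (at (log_height p t))"
      using level_deriv[of "log_height p t"] by (simp add: has_field_derivative_def speed_eq)
    show "(*) (- 2 * speed p t) \<circ> (*) (- 1 / (2 * speed p t)) = id"
      using speed_pos[of t] by (auto simp: fun_eq_iff)
  qed auto
  then show ?thesis by (simp add: has_field_derivative_def)
qed

lemma continuous_on_log_height: "continuous_on A (log_height p)"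
  by (intro continuous_at_imp_continuous_on ballI DERIV_isCont[OF log_height_deriv])

lemma continuous_on_speed [continuous_intros]:
  "continuous_on A f \<Longrightarrow> continuous_on A (\<lambda>x. speed p (f x))"
  unfolding speed_def
  by (intro continuous_intros continuous_on_compose2[OF continuous_on_log_height[of UNIV]]) auto

lemma log_height_le: "level p V \<le> t \<Longrightarrow> log_height p t \<le> V"
  using level_strict_anti[of V "log_height p t"] by (cases "log_height p t \<le> V") auto

text \<open>For such \<open>t\<close> the log height is at most zero, which caps the exponential in
  the speed by \<open>1\<close>.\<close>

lemma speed_le:
  assumes "t \<ge> 1"
  shows "speed p t \<le> t + 1"
proof -
  have "level p 0 \<le> 1" using p by (simp add: level_def)
  then have "level p 0 \<le> t" using assms by simp
  then have "log_height p t \<le> 0" by (rule log_height_le)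
  then show ?thesis using p by (simp add: speed_def mult_nonneg_nonpos)
qed

section \<open>Bounds for the slowness\<close>

lemma slowness_pos: "mu > 0 \<Longrightarrow> slowness p lam mu w > 0"
  by (simp add: slowness_def speed_pos)

text \<open>Uniform in \<open>w\<close> and small for large \<open>mu\<close>: high energy levels
  are passed quickly.\<close>

lemma slowness_le_const:
  assumes "mu > 0"
  shows "slowness p lam mu w \<le> (p + 1) / ((p - 1) * mu)"
proof -
  define t where "t = (w\<^sup>2 + lam) / mu"
  have "mu * ((p - 1) / (p + 1)) \<le> mu * speed p t"
    using assms by (intro mult_left_mono speed_ge) auto
  then have "1 / (mu * speed p t) \<le> 1 / (mu * ((p - 1) / (p + 1)))"
    using assms p by (intro divide_left_mono) (auto simp: speed_pos)
  then show ?thesis by (simp add: slowness_def t_def mult.commute)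
qed

text \<open>The nonlinearity only accelerates the descent of \<open>w\<close>, so the linear flow
  gives a bound independent of \<open>mu\<close>.\<close>

lemma slowness_le:
  assumes "mu > 0" and "w\<^sup>2 + lam > 0"
  shows "slowness p lam mu w \<le> 1 / (w\<^sup>2 + lam)"
proof -
  define t where "t = (w\<^sup>2 + lam) / mu"
  have t: "mu * t = w\<^sup>2 + lam" using assms by (simp add: t_def)
  have "mu * t \<le> mu * speed p t" using assms by (simp add: speed_def)
  then have "1 / (mu * speed p t) \<le> 1 / (mu * t)"
    using assms t by (intro divide_left_mono) (auto simp: speed_pos)
  then show ?thesis by (simp only: slowness_def t t_def[symmetric])
qed

text \<open>With the preceding upper bound this pins the slowness to that of the linear flow as
  \<open>mu\<close> tends to zero.\<close>

lemma slowness_ge: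
  assumes "mu > 0" and "w\<^sup>2 + lam \<ge> mu"
  shows "slowness p lam mu w \<ge> 1 / (w\<^sup>2 + lam + mu)"
proof -
  define t where "t = (w\<^sup>2 + lam) / mu"
  have t: "mu * t = w\<^sup>2 + lam" using assms(1) by (simp add: t_def)
  have "t \<ge> 1" unfolding t_def using assms by (subst le_divide_eq_1_pos)
  then have "mu * speed p t \<le> mu * (t + 1)"
    using assms(1) by (intro mult_left_mono speed_le) auto
  also have "\<dots> = w\<^sup>2 + lam + mu" by (simp add: distrib_left t)
  finally have "1 / (w\<^sup>2 + lam + mu) \<le> 1 / (mu * speed p t)"
  proof (rule divide_left_mono)
    show "0 < (w\<^sup>2 + lam + mu) * (mu * speed p t)"
      using assms speed_pos[of t] by (intro mult_pos_pos) auto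
  qed simp
  then show ?thesis by (simp only: slowness_def t_def[symmetric])
qed

lemma continuous_on_slowness: "continuous_on ({0<..} \<times> A) (\<lambda>(mu, w). slowness p lam mu w)"
  unfolding slowness_def case_prod_unfold
  by (intro continuous_intros) auto

lemma continuous_on_slowness2: "mu > 0 \<Longrightarrow> continuous_on A (slowness p lam mu)"
  unfolding slowness_def[abs_def]
  by (intro continuous_intros) auto

lemma slowness_integrable:
  assumes "mu > 0"
  shows "slowness p lam mu integrable_on {a..b}"
  using integrable_continuous_real[OF continuous_on_slowness2[OF assms]] .

lemma integral_slowness_nonneg:
  assumes "mu > 0"
  shows "0 \<le> integral {a..b} (slowness p lam mu)"
  by (rule integral_nonneg[OF slowness_integrable[OF assms]])
     (rule less_imp_le[OF slowness_pos[OF assms]])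

section \<open>Passage time as a function of the level\<close>

text \<open>Cutting the half-line above \<open>kappa\<close> into unit pieces turns the improper
  integral into a series, to which the Weierstrass test applies.\<close>

definition step_time :: "real \<Rightarrow> real \<Rightarrow> nat \<Rightarrow> real \<Rightarrow> real" where
  "step_time lam kappa i mu = integral {kappa + real i..kappa + real (Suc i)} (slowness p lam mu)"

lemma sum_step_time:
  assumes "mu > 0"
  shows "(\<Sum>i<n. step_time lam kappa i mu) = integral {kappa..kappa + real n} (slowness p lam mu)"
proof (induction n)
  case (Suc n)
  have "integral {kappa..kappa + real n} (slowness p lam mu) + step_time lam kappa n mu
      = integral {kappa..kappa + real (Suc n)} (slowness p lam mu)"
    unfolding step_time_def by (rule Henstock_Kurzweil_Integration.integral_combine) (auto intro: slowness_integrable assms)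
  then show ?case using Suc by simp
qed simp

text \<open>The slowness decays like the inverse square of \<open>w\<close>; the majorant is
  summable and free of \<open>mu\<close>, as uniform convergence requires.\<close>

lemma step_time_le:
  assumes mu: "mu > 0" and i: "real i \<ge> 4 * \<bar>kappa\<bar> + 4 * \<bar>lam\<bar> + 1"
  shows "step_time lam kappa i mu \<le> 4 * inverse ((real i)\<^sup>2)"
proof -
  define c where "c = 4 * inverse ((real i)\<^sup>2)"
  have "slowness p lam mu w \<le> c" if "w \<in> {kappa + real i..kappa + real (Suc i)}" for w
  proof -
    have i1: "real i \<ge> 1" using i by simp
    have "kappa + real i \<le> w" using that by simp
    \<comment> \<open>A quarter of \<open>i\<close> absorbs \<open>kappa\<close>, and a quarter of
      its square absorbs \<open>lam\<close>; what remains is \<open>9 / 16 - 1 / 4\<close>, which is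
      above \<open>1 / 4\<close>.\<close>
    then have "3 / 4 * real i \<le> w" using i by linarith
    then have "(3 / 4 * real i)\<^sup>2 \<le> w\<^sup>2" by (intro power_mono) auto
    then have 1: "9 / 16 * (real i)\<^sup>2 \<le> w\<^sup>2" by (simp add: power2_eq_square)
    have "real i * 1 \<le> (real i)\<^sup>2"
      unfolding power2_eq_square using i1 by (intro mult_left_mono) auto
    then have 2: "4 * \<bar>lam\<bar> \<le> (real i)\<^sup>2" using i by linarith
    have "(real i)\<^sup>2 > 0" using i1 by simp
    then have 3: "(real i)\<^sup>2 / 4 \<le> w\<^sup>2 + lam" "0 < (real i)\<^sup>2 / 4" using 1 2 by linarith+
    then have "slowness p lam mu w \<le> 1 / (w\<^sup>2 + lam)" using mu by (intro slowness_le) linarith+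
    also have "\<dots> \<le> 1 / ((real i)\<^sup>2 / 4)" using 3 by (intro divide_left_mono mult_pos_pos) linarith+
    also have "\<dots> = c" by (simp add: c_def inverse_eq_divide)
    finally show ?thesis .
  qed
  then have "step_time lam kappa i mu \<le> integral {kappa + real i..kappa + real (Suc i)} (\<lambda>_. c)"
    unfolding step_time_def by (intro integral_le slowness_integrable mu) auto
  then show ?thesis by (simp add: c_def)
qed

text \<open>Intermediate value theorem for the total time \<open>T\<close>, continuous as a uniform
  limit. It exceeds \<open>L\<close> at a low level, where the linear flow on \<open>{A..W}\<close>
  is approximated, and is below \<open>L\<close> at a high one. The detour over \<open>A\<close> is
  made because \<open>w\<^sup>2 + lam\<close> need not be positive down to
  \<open>kappa\<close>.\<close>

lemma exists_level_passage_time: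
  assumes "L > 0" and "kappa \<le> A" and "s0 > 0"
    and s0: "\<And>w. w \<in> {A..W} \<Longrightarrow> s0 \<le> w\<^sup>2 + lam"
    and long: "L < integral {A..W} (\<lambda>w. 1 / (w\<^sup>2 + lam))"
  shows "\<exists>mu>0. (\<lambda>n. integral {kappa..kappa + real n} (slowness p lam mu)) \<longlonglongrightarrow> L"
proof -
  define M where "M i = 4 * inverse ((real i)\<^sup>2)" for i
  define B where "B = step_time lam kappa"
  define T where "T mu = (\<Sum>i. B i mu)" for mu
  have M: "summable M"
    unfolding M_def by (intro summable_mult inverse_power_summable) simp
  obtain N0 where N0: "real N0 \<ge> 4 * \<bar>kappa\<bar> + 4 * \<bar>lam\<bar> + 1"
    using real_arch_simple by blast
  have BM: "B i mu \<le> M i" if "mu > 0" "i \<ge> N0" for i mu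
    unfolding B_def M_def using that N0 by (intro step_time_le) auto
  have B0: "B i mu \<ge> 0" if "mu > 0" for i mu
    unfolding B_def step_time_def by (rule integral_slowness_nonneg[OF that])
  have ev: "\<forall>\<^sub>F i in sequentially. \<forall>mu\<in>{0<..}. norm (B i mu) \<le> M i"
    unfolding eventually_sequentially using B0 BM by (intro exI[of _ N0]) auto
  have unif: "uniform_limit {0<..} (\<lambda>n mu. \<Sum>i<n. B i mu) T sequentially"
    unfolding T_def by (rule Weierstrass_m_test_ev[OF ev M])
  have sB: "summable (\<lambda>i. B i mu)" if "mu > 0" for mu
    by (rule summable_comparison_test_ev[OF _ M]) (use ev that in \<open>auto elim: eventually_mono\<close>)
  have contB: "continuous_on {0<..} (B i)" for i
  proof -
    have "continuous_on {0<..} (\<lambda>mu. integral (cbox (kappa + real i) (kappa + real (Suc i))) (slowness p lam mu))"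
      by (rule integral_continuous_on_param) (rule continuous_on_slowness)
    then show ?thesis by (simp add: B_def step_time_def[abs_def])
  qed
  have contT: "continuous_on {0<..} T"
    by (rule uniform_limit_theorem[OF _ unif]) (auto intro!: always_eventually continuous_intros contB)
  obtain m1 where m1: "m1 > 0" "T m1 > L"
  proof -
    define I where "I = integral {A..W} (\<lambda>w. 1 / (w\<^sup>2 + lam))"
    \<comment> \<open>Chosen so that \<open>L * (1 + e)\<close> is the midpoint of \<open>L\<close>
      and \<open>I\<close>.\<close>
    define e where "e = (I / L - 1) / 2"
    have e: "e > 0" using long assms(1) by (simp add: e_def I_def)
    have eI: "L * (1 + e) < I" using long assms(1) by (simp add: e_def I_def field_simps)
    \<comment> \<open>The bound by \<open>s0\<close> makes \<open>slowness_ge\<close> applicable;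
      the bound by \<open>s0 * e\<close> costs at most the factor \<open>1 + e\<close> against the
      linear flow.\<close>
    define mu where "mu = s0 * min 1 e"
    have mu: "mu > 0" "mu \<le> s0" "mu \<le> s0 * e"
      using assms(3) e by (auto simp: mu_def min_def)
    have cont1: "continuous_on {A..W} (\<lambda>w. 1 / (w\<^sup>2 + lam))"
      using s0 assms(3) by (intro continuous_intros) fastforce
    have ge: "1 / (1 + e) * (1 / (w\<^sup>2 + lam)) \<le> slowness p lam mu w" if "w \<in> {A..W}" for w
    proof -
      define s where "s = w\<^sup>2 + lam"
      have s: "s0 \<le> s" unfolding s_def using s0[OF that] .
      have "s0 * e \<le> s * e" using s e by (intro mult_right_mono) auto
      then have "s + mu \<le> s * (1 + e)" using mu(3) by (simp add: distrib_left)
      moreover have "0 < s + mu" using s mu(1) assms(3) by linarith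
      ultimately have "1 / (s * (1 + e)) \<le> 1 / (s + mu)"
        using s assms(3) e by (intro divide_left_mono mult_pos_pos) linarith+
      also have "\<dots> \<le> slowness p lam mu w"
        unfolding s_def by (rule slowness_ge) (use mu s in \<open>auto simp: s_def\<close>)
      finally show ?thesis by (simp add: s_def mult.commute)
    qed
    have "integral {A..W} (\<lambda>w. 1 / (1 + e) * (1 / (w\<^sup>2 + lam))) \<le> integral {A..W} (slowness p lam mu)"
      using ge by (intro integral_le slowness_integrable mu integrable_continuous_real
          continuous_on_mult continuous_on_const cont1) auto
    then have "I / (1 + e) \<le> integral {A..W} (slowness p lam mu)"
      by (simp only: integral_mult_right I_def[symmetric]) simp
    moreover have "L < I / (1 + e)" using eI e by (simp add: field_simps)
    ultimately have "L < integral {A..W} (slowness p lam mu)" by linarith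
    moreover obtain n where n: "W - kappa \<le> real n" using real_arch_simple by blast
    have "integral {A..W} (slowness p lam mu) \<le> integral {kappa..kappa + real n} (slowness p lam mu)"
      using n assms(2) mu(1)
      by (intro integral_subset_le slowness_integrable ballI less_imp_le[OF slowness_pos]) auto
    moreover have "(\<Sum>i<n. B i mu) \<le> T mu"
      unfolding T_def by (rule sum_le_suminf) (use sB B0 mu(1) in auto)
    ultimately have "L < T mu" using sum_step_time[OF mu(1), of lam kappa n] unfolding B_def by linarith
    then show ?thesis using that mu(1) by blast
  qed
  obtain m2 where m2: "m2 \<ge> m1" "T m2 < L"
  proof -
    \<comment> \<open>The tail of the series is below \<open>L / 2\<close> for every level at once;
      \<open>mu\<close> is then taken so large that the first \<open>N\<close> pieces also stay
      below \<open>L / 2\<close>.\<close>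
    obtain N1 where N1: "\<And>n. n \<ge> N1 \<Longrightarrow> norm (\<Sum>i. M (i + n)) < L / 2"
      using suminf_exist_split[of "L / 2" M] M assms(1) by auto
    define N where "N = max N0 N1"
    define q where "q = (p + 1) / (p - 1)"
    have q: "q > 0" using p by (simp add: q_def)
    define mu where "mu = max m1 (2 * q * real N / L + 1)"
    have mu: "mu \<ge> m1" "mu > 0" "2 * q * real N / L < mu" using m1(1) by (auto simp: mu_def)
    have "B i mu \<le> q / mu" for i
    proof -
      have "B i mu \<le> integral {kappa + real i..kappa + real (Suc i)} (\<lambda>_. q / mu)"
        unfolding B_def step_time_def
      proof (intro integral_le slowness_integrable mu)
        show "slowness p lam mu x \<le> q / mu" for x
          using slowness_le_const[OF mu(2), of lam x] by (simp add: q_def)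
      qed auto
      then show ?thesis by simp
    qed
    then have "(\<Sum>i<N. B i mu) \<le> (\<Sum>i<N. q / mu)" by (intro sum_mono)
    also have "\<dots> = real N * (q / mu)" by simp
    also have "\<dots> < L / 2" using mu q assms(1) by (simp add: field_simps)
    finally have 1: "(\<Sum>i<N. B i mu) < L / 2" .
    have "(\<Sum>i. B (i + N) mu) \<le> (\<Sum>i. M (i + N))"
      using mu(2) by (intro suminf_le BM summable_ignore_initial_segment M sB) (auto simp: N_def)
    also have "\<dots> < L / 2" using N1[of N] by (simp add: N_def)
    finally have 2: "(\<Sum>i. B (i + N) mu) < L / 2" .
    have "T mu = (\<Sum>i. B (i + N) mu) + (\<Sum>i<N. B i mu)"
      unfolding T_def by (rule suminf_split_initial_segment[OF sB[OF mu(2)]])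
    then show ?thesis using that mu(1) 1 2 by force
  qed
  have "continuous_on {m1..m2} T" by (rule continuous_on_subset[OF contT]) (use m1 in auto)
  then obtain mu where mu: "m1 \<le> mu" "T mu = L"
    using IVT2'[of T m2 L m1] m1 m2 by auto
  then have "mu > 0" using m1 by simp
  have "(\<lambda>n. \<Sum>i<n. B i mu) \<longlonglongrightarrow> T mu"
    unfolding T_def using summable_LIMSEQ[OF sB[OF \<open>mu > 0\<close>]] .
  then show ?thesis
    using \<open>mu > 0\<close> mu(2) by (auto simp: B_def sum_step_time)
qed

end

subsection \<open>Existence\<close>

text \<open>By the mean value theorem difference quotients at \<open>a\<close> are values of
  \<open>f'\<close> nearby. This serves the arc at \<open>0\<close>, where it is known only through
  limits because \<open>w\<close> is infinite there.\<close>

lemma has_derivative_at_left_endpoint: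
  fixes f f' :: "real \<Rightarrow> real"
  assumes "0 < b" and cont: "continuous_on {a..a + b} f"
    and der: "\<And>x. a < x \<Longrightarrow> x < a + b \<Longrightarrow> (f has_real_derivative f' x) (at x)"
    and lim: "(f' \<longlongrightarrow> l) (at_right a)"
  shows "(f has_real_derivative l) (at a within {a..a + b})"
  unfolding has_field_derivative_iff
proof (rule tendstoI)
  fix e :: real assume "e > 0"
  then have "\<forall>\<^sub>F x in at_right a. dist (f' x) l < e" using tendstoD[OF lim] by blast
  then obtain d where d: "d > a" "\<And>x. a < x \<Longrightarrow> x < d \<Longrightarrow> dist (f' x) l < e"
    unfolding eventually_at_right_field by blast
  have "dist ((f x - f a) / (x - a)) l < e" if x: "a < x" "x < d" "x \<le> a + b" for x
  proof -
    have "continuous_on {a..x} f" by (rule continuous_on_subset[OF cont]) (use x in auto)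
    moreover have "f differentiable (at y)" if "a < y" "y < x" for y
      using der[of y] that x by (auto simp: real_differentiable_def)
    ultimately obtain k z where z: "a < z" "z < x" "DERIV f z :> k" "f x - f a = (x - a) * k"
      using MVT[OF x(1)] by blast
    have "k = f' z" using DERIV_unique[OF z(3) der] z x by simp
    then show ?thesis using z d(2)[of z] x by simp
  qed
  then show "\<forall>\<^sub>F x in at a within {a..a + b}. dist ((f x - f a) / (x - a)) l < e"
    unfolding eventually_at using d(1)
    by (intro exI[of _ "d - a"]) (auto simp: dist_real_def)
qed

context superlinear_exponent
begin

lemma log_height_at_bot: "filterlim (log_height p) at_bot at_top"
  unfolding filterlim_at_bot eventually_at_top_linorder using log_height_le by blast

text \<open>The factor cancels the term of \<open>level\<close> that blows up as \<open>V\<close>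
  tends to minus infinity, so that the slope of the arc at \<open>0\<close> can be read off.\<close>

lemma level_times_exp: "level p V * exp (2 * V) = 1 - 2 / (p + 1) * exp ((p + 1) * V)"
proof -
  have "exp (- 2 * V) * exp (2 * V) = 1" by (simp flip: exp_add)
  moreover have "exp ((p - 1) * V) * exp (2 * V) = exp ((p + 1) * V)"
    by (simp flip: exp_add add: algebra_simps)
  ultimately show ?thesis by (simp only: level_def left_diff_distrib mult.assoc)
qed

text \<open>Integrating the slowness gives the position \<open>X w\<close> at which the quotient
  equals \<open>w\<close>. Its inverse \<open>W\<close> solves the Riccati equation, and the level
  relation turns \<open>W\<close> into the arc without a further integration.\<close>

lemma positive_arc_exists:
  assumes mu: "mu > 0" and L: "L > 0"
    and lim: "(\<lambda>n. integral {kappa..kappa + real n} (slowness p lam mu)) \<longlonglongrightarrow> L"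
  shows "\<exists>u u'. positive_arc p lam L u u' \<and> u' L = kappa * u L"
proof -
  define G where "G = slowness p lam mu"
  have contG: "continuous_on A G" for A unfolding G_def by (rule continuous_on_slowness2[OF mu])
  have intG: "G integrable_on {a..b}" for a b by (rule integrable_continuous_real[OF contG])
  have Gpos: "G w > 0" for w unfolding G_def by (rule slowness_pos[OF mu])
  \<comment> \<open>The margin below \<open>kappa\<close> makes \<open>X\<close> invertible on an
    open set around \<open>kappa\<close>, so that \<open>W\<close> is differentiable at
    \<open>L\<close> itself.\<close>
  define S where "S = {kappa - 1<..}"
  define X where "X w = L + integral {kappa - 1..kappa} G - integral {kappa - 1..w} G" for w
  have dX: "DERIV X w :> - G w" if "w \<in> S" for w
  proof -
    have "((\<lambda>w. integral {kappa - 1..w} G) has_real_derivative G w) (at w within {kappa - 1..w + 1})"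
      using that by (intro integral_has_real_derivative contG) (auto simp: S_def)
    then have "((\<lambda>w. integral {kappa - 1..w} G) has_real_derivative G w) (at w)"
      using that by (simp add: S_def at_within_Icc_at)
    then show ?thesis unfolding X_def by (auto intro!: derivative_eq_intros)
  qed
  have contX: "isCont X w" if "w \<in> S" for w using DERIV_isCont[OF dX[OF that]] .
  have Xanti: "X b < X a" if "a \<in> S" "a < b" for a b
  proof (rule DERIV_neg_imp_decreasing[OF that(2)])
    fix x assume "a \<le> x"
    then show "\<exists>y. DERIV X x :> y \<and> y < 0"
      using dX[of x] Gpos[of x] that by (intro exI[of _ "- G x"]) (auto simp: S_def)
  qed
  have Xkappa: "X kappa = L" by (simp add: X_def)
  have Xn: "X (kappa + real n) = L - integral {kappa..kappa + real n} G" for n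
    using Henstock_Kurzweil_Integration.integral_combine[OF _ _ intG, of "kappa - 1" kappa "kappa + real n"]
    by (simp add: X_def)
  have Xlim: "(\<lambda>n. X (kappa + real n)) \<longlonglongrightarrow> 0"
    unfolding Xn using tendsto_diff[OF tendsto_const lim, of L] by (simp add: G_def)
  have Xpos: "X w > 0" if "w \<in> S" for w
  proof -
    have w1: "w + 1 \<in> S" using that by (simp add: S_def)
    obtain n0 where n0: "w + 1 - kappa < real n0" using reals_Archimedean2 by blast
    have "X (kappa + real n) \<le> X (w + 1)" if "n \<ge> n0" for n
      using Xanti[OF w1, of "kappa + real n"] n0 that by simp
    then have "0 \<le> X (w + 1)" by (intro LIMSEQ_le_const2[OF Xlim] exI[of _ n0]) auto
    also have "X (w + 1) < X w" by (rule Xanti[OF that]) simp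
    finally show ?thesis .
  qed
  have injX: "inj_on X S"
    by (rule inj_onI) (metis Xanti less_irrefl linorder_cases)
  define W where "W = inv_into S X"
  have WX: "W (X w) = w" if "w \<in> S" for w
    unfolding W_def by (rule inv_into_f_f[OF injX that])
  have onto: "\<exists>w\<ge>kappa. X w = x" if x: "0 < x" "x \<le> L" for x
  proof -
    obtain n where n: "X (kappa + real n) < x"
      using order_tendstoD(2)[OF Xlim x(1)] unfolding eventually_sequentially by blast
    have "\<forall>y. kappa \<le> y \<and> y \<le> kappa + real n \<longrightarrow> isCont X y" using contX by (simp add: S_def)
    then show ?thesis
      using IVT2[of X "kappa + real n" x kappa] n x Xkappa by auto
  qed
  have W: "W x \<ge> kappa" "W x \<in> S" "X (W x) = x" if x: "0 < x" "x \<le> L" for x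
  proof -
    obtain w where w: "w \<ge> kappa" "X w = x" using onto[OF x] by blast
    then have "w \<in> S" by (simp add: S_def)
    then have "W x = w" using WX w by blast
    then show "W x \<ge> kappa" "W x \<in> S" "X (W x) = x" using w \<open>w \<in> S\<close> by auto
  qed
  have WL: "W L = kappa" using WX[of kappa] Xkappa by (simp add: S_def)
  have dW: "DERIV W x :> - (mu * speed p (((W x)\<^sup>2 + lam) / mu))" if x: "0 < x" "x \<le> L" for x
  proof -
    have "(W has_derivative (*) (- (1 / G (W x)))) (at (X (W x)))"
    proof (rule has_derivative_inverse_strong[where f = X and x = "W x" and S = S])
      show "open S" by (simp add: S_def)
      show "W x \<in> S" by (rule W(2)[OF x])
      show "continuous_on S X" using contX by (simp add: continuous_at_imp_continuous_on)
      show "(X has_derivative (*) (- G (W x))) (at (W x))"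
        using dX[OF W(2)[OF x]] by (simp add: has_field_derivative_def)
      show "(*) (- G (W x)) \<circ> (*) (- (1 / G (W x))) = id"
        using Gpos[of "W x"] by (auto simp: fun_eq_iff)
    qed (rule WX)
    then show ?thesis
      using W(3)[OF x] by (simp add: has_field_derivative_def G_def slowness_def)
  qed
  have Wtop: "filterlim W at_top (at_right 0)"
    unfolding filterlim_at_top
  proof
    fix Z
    define w where "w = max Z kappa"
    have w: "w \<in> S" "w \<ge> Z" by (auto simp: w_def S_def)
    have "W x \<ge> Z" if "0 < x" "x < min (X w) L" for x
    proof (rule ccontr)
      assume "\<not> W x \<ge> Z"
      then have "X w < X (W x)" using Xanti[of "W x" w] W(2)[of x] that w by auto
      then show False using W(3)[of x] that by simp
    qed
    then show "\<forall>\<^sub>F x in at_right 0. Z \<le> W x"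
      unfolding eventually_at_right_field using Xpos[OF w(1)] L
      by (intro exI[of _ "min (X w) L"]) auto
  qed
  define V where "V x = log_height p (((W x)\<^sup>2 + lam) / mu)" for x
  \<comment> \<open>This is the scale \<open>\<sigma>\<close> belonging to the level
    \<open>mu\<close>.\<close>
  define s where "s = mu powr (1 / (p - 1))"
  have s: "s > 0" "s powr (p - 1) = mu" using mu p by (simp_all add: s_def powr_powr)
  define z where "z x = s * exp (V x)" for x
  have dz: "DERIV z x :> W x * z x" if x: "0 < x" "x \<le> L" for x
  proof -
    define t where "t = ((W x)\<^sup>2 + lam) / mu"
    have "DERIV (\<lambda>x. ((W x)\<^sup>2 + lam) / mu) x :> 2 * W x * (- (mu * speed p t)) / mu"
      unfolding t_def using mu by (auto intro!: derivative_eq_intros dW[OF x])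
    then have "DERIV V x :> - 1 / (2 * speed p t) * (2 * W x * (- (mu * speed p t)) / mu)"
      unfolding V_def t_def by (rule DERIV_chain2[OF log_height_deriv])
    moreover have "- 1 / (2 * speed p t) * (2 * W x * (- (mu * speed p t)) / mu) = W x"
      using mu by (simp add: field_simps)
    ultimately have "DERIV V x :> W x" by simp
    then show ?thesis unfolding z_def by (auto intro!: derivative_eq_intros)
  qed
  have zpos: "z x > 0" for x using s by (simp add: z_def)
  have dz': "DERIV (\<lambda>x. W x * z x) x :> - (lam * z x + z x powr p)" if x: "0 < x" "x \<le> L" for x
  proof -
    define t where "t = ((W x)\<^sup>2 + lam) / mu"
    define e where "e = exp ((p - 1) * V x)"
    have "z x powr (p - 1) = mu * e"
      using s p by (simp add: z_def powr_mult e_def powr_def[of "exp _"])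
    moreover have "z x powr p = z x * z x powr (p - 1)"
      using zpos[of x] by (simp add: powr_mult_base)
    ultimately have "z x powr p = z x * (mu * e)" by simp
    moreover have "mu * t = (W x)\<^sup>2 + lam" using mu by (simp add: t_def)
    then have "mu * speed p t = (W x)\<^sup>2 + lam + mu * e"
      by (simp add: speed_def V_def e_def t_def[symmetric] distrib_left)
    moreover have "DERIV (\<lambda>x. W x * z x) x :> - (mu * speed p t) * z x + W x * (W x * z x)"
      unfolding t_def by (auto intro!: derivative_eq_intros dW[OF x] dz[OF x])
    ultimately show ?thesis by (simp add: algebra_simps power2_eq_square)
  qed
  have Vbot: "filterlim V at_bot (at_right 0)"
  proof -
    have "filterlim (\<lambda>x. W x * W x) at_top (at_right 0)" by (intro filterlim_at_top_mult_at_top Wtop)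
    then have "filterlim (\<lambda>x. lam + W x * W x) at_top (at_right 0)"
      by (intro filterlim_tendsto_add_at_top[OF tendsto_const])
    then have "filterlim (\<lambda>x. 1 / mu * (lam + W x * W x)) at_top (at_right 0)"
      using mu by (intro filterlim_tendsto_pos_mult_at_top[OF tendsto_const]) auto
    then have "filterlim (\<lambda>x. ((W x)\<^sup>2 + lam) / mu) at_top (at_right 0)"
      by (simp add: power2_eq_square add.commute)
    then show ?thesis unfolding V_def by (rule filterlim_compose[OF log_height_at_bot])
  qed
  have explim: "((\<lambda>x. exp (c * V x)) \<longlongrightarrow> 0) (at_right 0)" if "c > 0" for c
    by (intro filterlim_compose[OF exp_at_bot] filterlim_tendsto_pos_mult_at_bot[OF tendsto_const that Vbot])
  have zlim: "(z \<longlongrightarrow> 0) (at_right 0)"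
    unfolding z_def using tendsto_mult[OF tendsto_const explim[of 1], of s] by simp
  have wzlim: "((\<lambda>x. W x * z x) \<longlongrightarrow> s * sqrt mu) (at_right 0)"
  proof -
    \<comment> \<open>The level relation solved for the slope; the sign of \<open>W x\<close>
      selects the positive root, and the right-hand side has a limit as \<open>V x\<close> tends to
      minus infinity.\<close>
    have eq: "W x * z x = s * sqrt (mu * (1 - 2 / (p + 1) * exp ((p + 1) * V x)) - lam * exp (2 * V x))"
      if "W x \<ge> 0" for x
    proof -
      have "(W x * exp (V x))\<^sup>2 = (W x)\<^sup>2 * exp (2 * V x)"
        by (simp add: power_mult_distrib power2_eq_square flip: exp_add)
      moreover have "(W x)\<^sup>2 = mu * level p (V x) - lam"
        using mu by (simp add: V_def)
      ultimately have "(W x * exp (V x))\<^sup>2 = mu * (level p (V x) * exp (2 * V x)) - lam * exp (2 * V x)"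
        by (simp only: left_diff_distrib mult.assoc)
      then have "W x * exp (V x)
          = sqrt (mu * (1 - 2 / (p + 1) * exp ((p + 1) * V x)) - lam * exp (2 * V x))"
        unfolding level_times_exp[symmetric] using that by (intro real_sqrt_unique[symmetric]) auto
      then show ?thesis by (simp add: z_def)
    qed
    have "((\<lambda>x. s * sqrt (mu * (1 - 2 / (p + 1) * exp ((p + 1) * V x)) - lam * exp (2 * V x)))
        \<longlongrightarrow> s * sqrt (mu * (1 - 2 / (p + 1) * 0) - lam * 0)) (at_right 0)"
      using p by (intro tendsto_intros explim) auto
    moreover have "\<forall>\<^sub>F x in at_right 0. W x \<ge> 0"
      by (rule Wtop[unfolded filterlim_at_top, rule_format])
    then have "\<forall>\<^sub>F x in at_right 0.
        s * sqrt (mu * (1 - 2 / (p + 1) * exp ((p + 1) * V x)) - lam * exp (2 * V x)) = W x * z x"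
      by (rule eventually_mono) (rule eq[symmetric])
    ultimately have "((\<lambda>x. W x * z x) \<longlongrightarrow> s * sqrt (mu * (1 - 2 / (p + 1) * 0) - lam * 0)) (at_right 0)"
      by (rule Lim_transform_eventually)
    then show ?thesis by simp
  qed
  \<comment> \<open>\<open>0\<close> is not a value of \<open>X\<close> on \<open>S\<close>, so
    \<open>W 0\<close> carries no meaning and both functions are extended by their limits.\<close>
  define u where "u x = (if x \<le> 0 then 0 else z x)" for x
  define u' where "u' x = (if x \<le> 0 then s * sqrt mu else W x * z x)" for x
  have du: "DERIV u x :> u' x" if x: "0 < x" "x \<le> L" for x
  proof (rule has_field_derivative_transform_within_open[of z _ _ "{0<..}"])
    show "DERIV z x :> u' x" using dz[OF x] x by (simp add: u'_def)
  qed (use x in \<open>auto simp: u_def\<close>)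
  have du': "DERIV u' x :> - (lam * u x + u x powr p)" if x: "0 < x" "x \<le> L" for x
  proof (rule has_field_derivative_transform_within_open[of "\<lambda>x. W x * z x" _ _ "{0<..}"])
    show "DERIV (\<lambda>x. W x * z x) x :> - (lam * u x + u x powr p)" using dz'[OF x] x by (simp add: u_def)
  qed (use x in \<open>auto simp: u'_def\<close>)
  have right: "at 0 within {0..L} = at_right (0::real)" using L by (simp add: at_within_Icc_at_right)
  have pos_ev: "\<forall>\<^sub>F x in at_right 0. 0 < (x::real)" by (rule eventually_at_right_less)
  have ulim: "(u \<longlongrightarrow> 0) (at_right 0)"
    by (rule Lim_transform_eventually[OF zlim eventually_mono[OF pos_ev]]) (simp add: u_def)
  have u'lim: "(u' \<longlongrightarrow> s * sqrt mu) (at_right 0)"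
    by (rule Lim_transform_eventually[OF wzlim eventually_mono[OF pos_ev]]) (simp add: u'_def)
  have cont: "continuous_on {0..L} u" "continuous_on {0..L} u'"
  proof -
    have cont: "continuous_on {0..L} f"
      if "(f \<longlongrightarrow> f 0) (at_right 0)" "\<And>x. 0 < x \<Longrightarrow> x \<le> L \<Longrightarrow> isCont f x"
      for f :: "real \<Rightarrow> real"
      unfolding continuous_on_eq_continuous_within
    proof
      fix x assume "x \<in> {0..L}"
      then show "continuous (at x within {0..L}) f"
        using that(1) right continuous_at_imp_continuous_at_within[OF that(2)[of x]]
        by (cases "x = 0") (simp_all add: continuous_within)
    qed
    show "continuous_on {0..L} u"
      using ulim DERIV_isCont[OF du] by (intro cont) (simp_all add: u_def)
    show "continuous_on {0..L} u'"
      using u'lim DERIV_isCont[OF du'] by (intro cont) (simp_all add: u'_def)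
  qed
  have d0: "(u has_real_derivative u' 0) (at 0 within {0..L})"
  proof -
    have "(u has_real_derivative s * sqrt mu) (at 0 within {0..0 + L})"
      by (rule has_derivative_at_left_endpoint[OF L _ _ u'lim]) (use cont(1) in \<open>auto intro: du\<close>)
    then show ?thesis by (simp add: u'_def)
  qed
  have "(u has_real_derivative u' x) (at x within {0..L})" if "x \<in> {0..L}" for x
    using d0 du[of x] that by (cases "x = 0") (auto intro: has_field_derivative_at_within)
  then have "positive_arc p lam L u u'"
    unfolding positive_arc_def using cont(2) du' zpos by (auto simp: u_def)
  moreover have "u' L = kappa * u L" using L by (simp add: u_def u'_def WL)
  ultimately show ?thesis by blast
qed

end

section \<open>Middle piece and gluing\<close>

text \<open>A point outside a closed set is no limit point of it, so only the pieces that contain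
  \<open>x\<close> impose a condition.\<close>

lemma has_real_derivative_within_Un:
  fixes f :: "real \<Rightarrow> real"
  assumes "closed S" and "closed T"
    and "x \<in> S \<Longrightarrow> (f has_real_derivative d) (at x within S)"
    and "x \<in> T \<Longrightarrow> (f has_real_derivative d) (at x within T)"
  shows "(f has_real_derivative d) (at x within (S \<union> T))"
proof -
  have "(f has_real_derivative d) (at x within R)"
    if "closed R" and "x \<in> R \<Longrightarrow> (f has_real_derivative d) (at x within R)" for R
  proof (cases "x \<in> R")
    case False
    then have "at x within R = bot"
      using that(1) closed_limpt[of R] trivial_limit_within[of x R] by blast
    then show ?thesis by (simp add: has_field_derivative_iff)
  qed (use that in blast)
  then show ?thesis
    using assms unfolding has_field_derivative_iff Lim_within_Un by blast
qed

text \<open>The last clause says that the linear Riccati flow \<open>w' = - (w\<^sup>2 + lam)\<close> takes longer than \<open>L\<close> to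
  come down from infinity to \<open>c' / c\<close> at \<open>L\<close>; this is where \<open>lam < pi\<^sup>2\<close> enters.\<close>
lemma middle_profile_exists:
  assumes lam: "lam < pi\<^sup>2" and L: "0 < L" "L < 1 / 2"
  shows "\<exists>c c' A W s0. (\<forall>x. (c has_real_derivative c' x) (at x))
    \<and> (\<forall>x. (c' has_real_derivative - (lam * c x)) (at x))
    \<and> (\<forall>x. c (1 - x) = c x) \<and> (\<forall>x. c' (1 - x) = - c' x) \<and> (\<forall>x\<in>{L..1 - L}. c x > 0)
    \<and> c' L / c L \<le> A \<and> s0 > 0 \<and> (\<forall>w\<in>{A..W}. s0 \<le> w\<^sup>2 + lam)
    \<and> L < integral {A..W} (\<lambda>w. 1 / (w\<^sup>2 + lam))"
proof (cases "lam > 0")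
  case True
  define r where "r = sqrt lam"
  have r: "r > 0" "r\<^sup>2 = lam" "r < pi"
    using True lam by (simp_all add: r_def real_less_lsqrt)
  define c c' where "c x = cos (r * (x - 1 / 2))" and "c' x = - r * sin (r * (x - 1 / 2))" for x
  define q where "q = 1 / 2 - L"
  have q: "0 < q" "q < 1 / 2" using L by (auto simp: q_def)
  have rq: "0 < r * q" "r * q < pi / 2"
    using q r mult_strict_mono[of r pi q "1 / 2"] by auto
  have sym: "r * ((1 - x) - 1 / 2) = - (r * (x - 1 / 2))" for x :: real by (simp add: algebra_simps)
  have cpos: "c x > 0" if "x \<in> {L..1 - L}" for x
  proof -
    have "\<bar>x - 1 / 2\<bar> \<le> q" using that by (auto simp: q_def abs_le_iff)
    then have "r * \<bar>x - 1 / 2\<bar> \<le> r * q" using r by (intro mult_left_mono) auto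
    moreover have "\<bar>r * (x - 1 / 2)\<bar> = r * \<bar>x - 1 / 2\<bar>" using r by (simp add: abs_mult)
    ultimately have "\<bar>r * (x - 1 / 2)\<bar> < pi / 2" using rq(2) by linarith
    then show ?thesis unfolding c_def by (intro cos_gt_zero_pi) (auto simp: abs_less_iff)
  qed
  define kappa where "kappa = c' L / c L"
  have "r * (L - 1 / 2) = - (r * q)" by (simp add: q_def algebra_simps)
  then have kappa: "kappa = r * tan (r * q)"
    by (simp add: kappa_def c_def c'_def tan_def)
  have "((\<lambda>W. arctan (W / r)) \<longlongrightarrow> pi / 2) at_top"
  proof (rule filterlim_compose[OF tendsto_arctan_at_top])
    have "filterlim (\<lambda>W. 1 / r * W) at_top at_top"
      using r by (intro filterlim_tendsto_pos_mult_at_top[OF tendsto_const _ filterlim_ident]) simp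
    then show "filterlim (\<lambda>W. W / r) at_top at_top" by simp
  qed
  \<comment> \<open>Since \<open>L + q = 1 / 2\<close>, this is exactly \<open>r < pi\<close>. The
    linear flow needs the time \<open>(pi / 2 - r * q) / r\<close> from infinity to
    \<open>kappa\<close>, hence longer than \<open>L\<close>.\<close>
  moreover have "r * L + r * q < pi / 2" using r by (simp add: q_def algebra_simps)
  ultimately have "\<forall>\<^sub>F W in at_top. r * L + r * q < arctan (W / r)"
    by (rule order_tendstoD)
  then obtain W where W: "W \<ge> kappa" "r * L + r * q < arctan (W / r)"
    unfolding eventually_at_top_linorder by (meson max.cobounded1 max.cobounded2)
  have "((\<lambda>w. 1 / (w\<^sup>2 + lam)) has_integral arctan (W / r) / r - arctan (kappa / r) / r) {kappa..W}"
  proof (rule fundamental_theorem_of_calculus[OF W(1)])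
    fix w
    have "r * r * (1 + (w / r)\<^sup>2) = w\<^sup>2 + lam"
      unfolding r(2)[symmetric] using r(1) by (simp add: power_divide power2_eq_square distrib_left)
    moreover have "inverse X * (1 / r) / r = 1 / (r * r * X)" for X
      by (simp add: inverse_eq_divide)
    ultimately have "inverse (1 + (w / r)\<^sup>2) * (1 / r) / r = 1 / (w\<^sup>2 + lam)"
      by (simp only:)
    moreover have "((\<lambda>w. arctan (w / r) / r) has_real_derivative
        inverse (1 + (w / r)\<^sup>2) * (1 / r) / r) (at w within {kappa..W})"
      by (rule DERIV_cdivide[OF DERIV_chain2[OF DERIV_arctan DERIV_cdivide[OF DERIV_ident]]])
    ultimately have "((\<lambda>w. arctan (w / r) / r) has_real_derivative 1 / (w\<^sup>2 + lam)) (at w within {kappa..W})"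
      by simp
    then show "((\<lambda>w. arctan (w / r) / r) has_vector_derivative 1 / (w\<^sup>2 + lam)) (at w within {kappa..W})"
      by (simp add: has_real_derivative_iff_has_vector_derivative)
  qed
  moreover have "arctan (kappa / r) = r * q" using r rq by (simp add: kappa arctan_tan)
  ultimately have "integral {kappa..W} (\<lambda>w. 1 / (w\<^sup>2 + lam)) = (arctan (W / r) - r * q) / r"
    using r by (simp add: integral_unique diff_divide_distrib)
  moreover have "L < (arctan (W / r) - r * q) / r" using W(2) r by (simp add: field_simps)
  ultimately have long: "L < integral {kappa..W} (\<lambda>w. 1 / (w\<^sup>2 + lam))" by simp
  have dc: "(c has_real_derivative c' x) (at x)" for x
    unfolding c_def c'_def by (auto intro!: derivative_eq_intros)
  have dc': "(c' has_real_derivative - (lam * c x)) (at x)" for x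
    unfolding c_def c'_def r(2)[symmetric]
    by (auto intro!: derivative_eq_intros simp: power2_eq_square)
  have csym: "c (1 - x) = c x" "c' (1 - x) = - c' x" for x
    unfolding c_def c'_def sym by simp_all
  have "\<forall>w\<in>{kappa..W}. lam \<le> w\<^sup>2 + lam" by simp
  then show ?thesis
    using dc dc' csym cpos long True
    by (intro exI[of _ c] exI[of _ c'] exI[of _ kappa] exI[of _ W] exI[of _ lam])
       (auto simp: kappa_def)
next
  case False
  define r where "r = sqrt (- lam)"
  have r: "r \<ge> 0" "r\<^sup>2 = - lam" using False by (simp_all add: r_def)
  define c c' where "c x = cosh (r * (x - 1 / 2))" and "c' x = r * sinh (r * (x - 1 / 2))" for x
  have sym: "r * ((1 - x) - 1 / 2) = - (r * (x - 1 / 2))" for x :: real by (simp add: algebra_simps)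
  have dc: "(c has_real_derivative c' x) (at x)" for x
    unfolding c_def c'_def by (auto intro!: derivative_eq_intros)
  have dc': "(c' has_real_derivative - (lam * c x)) (at x)" for x
  proof -
    have "- (lam * c x) = r * r * c x" using r(2) by (simp add: power2_eq_square)
    then show ?thesis
      unfolding c_def c'_def by (auto intro!: derivative_eq_intros)
  qed
  have csym: "c (1 - x) = c x" "c' (1 - x) = - c' x" for x
    unfolding c_def c'_def sym by simp_all
  have cpos: "c x > 0" for x by (simp add: c_def cosh_real_pos)
  have "r * (L - 1 / 2) \<le> 0" using r L by (intro mult_nonneg_nonpos) auto
  then have "c' L \<le> 0" unfolding c'_def using r by (intro mult_nonneg_nonpos) auto
  then have kappa: "c' L / c L \<le> 0" using cpos[of L] by (simp add: divide_nonpos_pos)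
  \<comment> \<open>The linear flow stalls near \<open>r\<close>: on \<open>{A..W}\<close> the
    factor \<open>w + r\<close> is at most \<open>b\<close>, and the integral of
    \<open>1 / (b * (w - r))\<close> diverges logarithmically as \<open>A\<close> approaches
    \<open>r\<close>. The choice of \<open>d\<close> makes it equal to \<open>L + 1\<close>.\<close>
  define b where "b = 2 * r + 1"
  define d where "d = exp (- (b * (L + 1)))"
  have b: "b > 0" using r by (simp add: b_def)
  have d: "0 < d" "d < 1" using b L by (simp_all add: d_def)
  define A W where "A = r + d" and "W = r + 1"
  have AW: "A \<le> W" using d by (simp add: A_def W_def)
  have fac: "w\<^sup>2 + lam = (w - r) * (w + r)" for w
    using r(2) by (simp add: algebra_simps power2_eq_square)
  have w: "d * d \<le> w\<^sup>2 + lam" "1 / (b * (w - r)) \<le> 1 / (w\<^sup>2 + lam)" if "w \<in> {A..W}" for w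
  proof -
    have w: "d \<le> w - r" "d \<le> w + r" "w + r \<le> b" using that r d by (auto simp: A_def W_def b_def)
    then show 1: "d * d \<le> w\<^sup>2 + lam" unfolding fac using d by (intro mult_mono) auto
    have "w\<^sup>2 + lam \<le> (w - r) * b" unfolding fac using w d by (intro mult_left_mono) auto
    moreover have "0 < d * d" using d by simp
    ultimately have pos: "0 < w\<^sup>2 + lam" "0 < w - r" and "w\<^sup>2 + lam \<le> b * (w - r)"
      using 1 w d by (linarith, linarith, simp add: mult.commute)
    then show "1 / (b * (w - r)) \<le> 1 / (w\<^sup>2 + lam)"
      using b by (intro divide_left_mono mult_pos_pos) auto
  qed
  have lower: "((\<lambda>w. 1 / (b * (w - r))) has_integral ln (W - r) / b - ln (A - r) / b) {A..W}"
  proof (rule fundamental_theorem_of_calculus[OF AW])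
    fix w assume "w \<in> {A..W}"
    then have "w - r > 0" using d by (simp add: A_def)
    then have "((\<lambda>w. ln (w - r) / b) has_real_derivative 1 / (b * (w - r))) (at w within {A..W})"
      using b by (auto intro!: derivative_eq_intros)
    then show "((\<lambda>w. ln (w - r) / b) has_vector_derivative 1 / (b * (w - r))) (at w within {A..W})"
      by (simp add: has_real_derivative_iff_has_vector_derivative)
  qed
  have nz: "w\<^sup>2 + lam \<noteq> 0" if "w \<in> {A..W}" for w
    using w(1)[OF that] mult_pos_pos[OF d(1) d(1)] by linarith
  have "integral {A..W} (\<lambda>w. 1 / (b * (w - r))) \<le> integral {A..W} (\<lambda>w. 1 / (w\<^sup>2 + lam))"
  proof (rule integral_le[OF has_integral_integrable[OF lower]])
    show "(\<lambda>w. 1 / (w\<^sup>2 + lam)) integrable_on {A..W}"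
      using nz by (intro integrable_continuous_real continuous_intros) auto
  qed (rule w(2))
  moreover have "integral {A..W} (\<lambda>w. 1 / (b * (w - r))) = L + 1"
    using integral_unique[OF lower] b by (simp add: A_def W_def d_def)
  ultimately have long: "L < integral {A..W} (\<lambda>w. 1 / (w\<^sup>2 + lam))" by simp
  have "c' L / c L \<le> A" using kappa r d by (simp add: A_def)
  then show ?thesis
    using dc dc' csym cpos long w(1) d
    by (intro exI[of _ c] exI[of _ c'] exI[of _ A] exI[of _ W] exI[of _ "d * d"]) auto
qed

text \<open>Scaling the middle profile matches the values at \<open>L\<close>, and equality of the
  quotients then matches the slopes; the right piece is the mirror image of the arc.\<close>

lemma glued_positive_solution:
  assumes h: "0 < h" "h < 1" and L_def: "L = (1 - h) / 2"
    and arc: "positive_arc p lam L u u'"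
    and dc: "\<And>x. (c has_real_derivative c' x) (at x)"
    and dc': "\<And>x. (c' has_real_derivative - (lam * c x)) (at x)"
    and csym: "\<And>x. c (1 - x) = c x" "\<And>x. c' (1 - x) = - c' x"
    and cpos: "\<And>x. x \<in> {L..1 - L} \<Longrightarrow> c x > 0"
    and match: "u' L = c' L / c L * u L"
  shows "\<exists>v. is_positive_solution p h lam v \<and> is_symmetric v"
proof -
  have L: "0 < L" "L < 1 / 2" using h by (auto simp: L_def field_simps)
  have R: "(1 + h) / 2 = 1 - L" and R': "(1 - h) / 2 = L" by (auto simp: L_def field_simps)
  have a: "a_h h x = (if L < x \<and> x < 1 - L then 0 else 1)" for x
    unfolding a_h_def R R' ..
  note U = arc[unfolded positive_arc_def]
  have du: "(u has_real_derivative u' x) (at x within {0..L})" if "x \<in> {0..L}" for x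
    using U that by blast
  have ddu: "(u' has_real_derivative - (lam * u x + u x powr p)) (at x)" if "x \<in> {0<..<L}" for x
    using U that by blast
  have cu': "continuous_on {0..L} u'" and u0: "u 0 = 0" and upos: "\<And>x. x \<in> {0<..L} \<Longrightarrow> u x > 0"
    using U by blast+
  define q where "q = u L / c L"
  have cL: "c L > 0" and uL: "u L > 0" using cpos[of L] upos[of L] L by auto
  have q: "q > 0" "q * c L = u L" "q * c' L = u' L" using cL uL by (simp_all add: q_def match)
  define v where "v x = (if x < L then u x else if x \<le> 1 - L then q * c x else u (1 - x))" for x
  define v' where "v' x = (if x < L then u' x else if x \<le> 1 - L then q * c' x else - u' (1 - x))" for x
  \<comment> \<open>The formulas agree at \<open>L\<close> and \<open>1 - L\<close>, so each holds
    on a closed interval; this is what allows gluing of derivatives and continuity.\<close>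
  have v1: "v x = u x" "v' x = u' x" if "x \<in> {0..L}" for x
    using that q L by (auto simp: v_def v'_def)
  have v2: "v x = q * c x" "v' x = q * c' x" if "x \<in> {L..1 - L}" for x
    using that by (auto simp: v_def v'_def)
  have v3: "v x = u (1 - x)" "v' x = - u' (1 - x)" if "x \<in> {1 - L..1}" for x
    using that q L csym[of L] by (auto simp: v_def v'_def)
  have split: "{0..1} = {0..L} \<union> ({L..1 - L} \<union> {1 - L..1})" using L by auto
  have dv: "(v has_real_derivative v' x) (at x within {0..1})" for x
    unfolding split
  proof (intro has_real_derivative_within_Un closed_Un closed_real_atLeastAtMost)
    assume x: "x \<in> {0..L}"
    show "(v has_real_derivative v' x) (at x within {0..L})"
      unfolding v1(2)[OF x]
      by (rule has_field_derivative_transform_within[OF du[OF x] zero_less_one x]) (simp add: v1)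
  next
    assume x: "x \<in> {L..1 - L}"
    have "((\<lambda>x. q * c x) has_real_derivative q * c' x) (at x within {L..1 - L})"
      by (intro DERIV_cmult has_field_derivative_at_within[OF dc])
    then show "(v has_real_derivative v' x) (at x within {L..1 - L})"
      unfolding v2(2)[OF x]
      by (rule has_field_derivative_transform_within[OF _ zero_less_one x]) (simp add: v2)
  next
    assume x: "x \<in> {1 - L..1}"
    have "(u has_real_derivative u' (1 - x)) (at (1 - x) within {0..L})"
      using x by (intro du) auto
    moreover have "(\<lambda>x. 1 - x) ` {1 - L..1} = {0..L}" by auto
    ultimately have "((u \<circ> (\<lambda>x. 1 - x)) has_real_derivative u' (1 - x) * (- 1)) (at x within {1 - L..1})"
      by (intro DERIV_image_chain) (auto intro!: derivative_eq_intros)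
    then have "((\<lambda>x. u (1 - x)) has_real_derivative - u' (1 - x)) (at x within {1 - L..1})"
      by (simp add: o_def)
    then show "(v has_real_derivative v' x) (at x within {1 - L..1})"
      unfolding v3(2)[OF x]
      by (rule has_field_derivative_transform_within[OF _ zero_less_one x]) (simp add: v3)
  qed
  have "continuous_on {0..L} v'" using cu' by (rule continuous_on_eq) (simp add: v1)
  moreover have "continuous_on {L..1 - L} (\<lambda>x. q * c' x)"
    by (intro continuous_intros DERIV_continuous_on[OF has_field_derivative_at_within[OF dc']])
  then have "continuous_on {L..1 - L} v'" by (rule continuous_on_eq) (simp add: v2)
  moreover have "continuous_on {1 - L..1} (\<lambda>x. - u' (1 - x))"
    by (intro continuous_intros continuous_on_compose2[OF cu']) auto
  then have "continuous_on {1 - L..1} v'" by (rule continuous_on_eq) (simp add: v3)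
  ultimately have cv': "continuous_on {0..1} v'"
    unfolding split by (intro continuous_on_closed_Un closed_Un closed_real_atLeastAtMost)
  have ddv: "(v' has_real_derivative - (lam * v x + a_h h x * v x powr p)) (at x)"
    if "x \<in> {0<..<1} - {L, 1 - L}" for x
  proof -
    have "0 < x" "x < 1" "x \<noteq> L" "x \<noteq> 1 - L" using that by auto
    then consider "x \<in> {0<..<L}" | "x \<in> {L<..<1 - L}" | "x \<in> {1 - L<..<1}"
      by (cases "x < L"; cases "x < 1 - L") (simp_all add: not_less le_less)
    then show ?thesis
    proof cases
      case 1
      then have eq: "- (lam * v x + a_h h x * v x powr p) = - (lam * u x + u x powr p)"
        by (simp add: a v1)
      show ?thesis
        unfolding eq
        by (rule has_field_derivative_transform_within_open[OF ddu[OF 1], of "{0<..<L}"])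
           (use 1 in \<open>auto simp: v1\<close>)
    next
      case 2
      then have eq: "- (lam * v x + a_h h x * v x powr p) = q * - (lam * c x)"
        by (simp add: a v2)
      show ?thesis
        unfolding eq
        by (rule has_field_derivative_transform_within_open[OF DERIV_cmult[OF dc'], of "{L<..<1 - L}"])
           (use 2 in \<open>auto simp: v2\<close>)
    next
      case 3
      define y where "y = 1 - x"
      have y: "y \<in> {0<..<L}" using 3 by (auto simp: y_def)
      have eq: "- (lam * v x + a_h h x * v x powr p) = - (lam * u y + u y powr p)"
        using 3 by (simp add: a v3 y_def)
      have "((\<lambda>x. 1 - x) has_real_derivative - 1) (at x)" by (auto intro!: derivative_eq_intros)
      then have "((\<lambda>x. u' (1 - x)) has_real_derivative - (lam * u y + u y powr p) * (- 1)) (at x)"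
        by (rule DERIV_chain2[of u', rotated]) (use ddu[OF y] in \<open>simp add: y_def\<close>)
      from DERIV_minus[OF this]
      have "((\<lambda>x. - u' (1 - x)) has_real_derivative - (lam * u y + u y powr p)) (at x)"
        by (simp add: add.commute)
      then show ?thesis
        unfolding eq
        by (rule has_field_derivative_transform_within_open[of _ _ _ "{1 - L<..<1}"])
           (use 3 in \<open>auto simp: v3\<close>)
    qed
  qed
  have "v 0 = 0" "v 1 = 0" using v1[of 0] v3[of 1] u0 L by auto
  then have "is_solution p h lam v"
    unfolding is_solution_def R R' using dv cv' ddv by blast
  moreover have "v x > 0" if x: "x \<in> {0<..<1}" for x
  proof -
    consider "x \<in> {0<..L}" | "x \<in> {L..1 - L}" | "x \<in> {1 - L..<1}"
      using x by (cases "x \<le> L"; cases "x \<le> 1 - L") auto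
    then show ?thesis
    proof cases
      case 1
      then show ?thesis using v1[of x] upos[of x] by auto
    next
      case 2
      then show ?thesis using v2[of x] cpos[of x] q by auto
    next
      case 3
      then show ?thesis using v3[of x] upos[of "1 - x"] by auto
    qed
  qed
  moreover have "v x = v (1 - x)" if x: "x \<in> {0..1}" for x
  proof -
    consider "x \<in> {0..L}" | "x \<in> {L..1 - L}" | "x \<in> {1 - L..1}"
      using x by (cases "x \<le> L"; cases "x \<le> 1 - L") auto
    then show ?thesis
    proof cases
      case 1
      then show ?thesis using v1[of x] v3[of "1 - x"] by auto
    next
      case 2
      then show ?thesis using v2[of x] v2[of "1 - x"] csym[of x] by auto
    next
      case 3
      then show ?thesis using v3[of x] v1[of "1 - x"] by auto
    qed
  qed
  ultimately show ?thesis
    unfolding is_positive_solution_def is_symmetric_def by blast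
qed

theorem theorem2p1:
  fixes p h :: real
  assumes "p > 1" and "0 < h" and "h < 1"
  shows "(\<forall>lam < pi\<^sup>2. \<exists>u. is_positive_solution p h lam u \<and> is_symmetric u \<and>
            (\<forall>v. is_positive_solution p h lam v \<and> is_symmetric v \<longrightarrow> (\<forall>x\<in>{0..1}. v x = u x)))
         \<and> (\<forall>lam. (\<exists>u. is_positive_solution p h lam u) \<longleftrightarrow> lam < pi\<^sup>2)"
proof -
  interpret superlinear_exponent p by standard (rule assms(1))
  define L where "L = (1 - h) / 2"
  have L: "0 < L" "L < 1 / 2" using assms by (auto simp: L_def field_simps)
  have exists: "\<exists>u. is_positive_solution p h lam u \<and> is_symmetric u" if lam: "lam < pi\<^sup>2" for lam
  proof -
    obtain c c' A W s0 where dc: "\<And>x. (c has_real_derivative c' x) (at x)"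
      and dc': "\<And>x. (c' has_real_derivative - (lam * c x)) (at x)"
      and csym: "\<And>x. c (1 - x) = c x" "\<And>x. c' (1 - x) = - c' x"
      and cpos: "\<And>x. x \<in> {L..1 - L} \<Longrightarrow> c x > 0"
      and slow: "c' L / c L \<le> A" "s0 > 0" "\<And>w. w \<in> {A..W} \<Longrightarrow> s0 \<le> w\<^sup>2 + lam"
        "L < integral {A..W} (\<lambda>w. 1 / (w\<^sup>2 + lam))"
      using middle_profile_exists[OF lam L] by blast
    obtain mu where mu: "mu > 0"
      "(\<lambda>n. integral {c' L / c L..c' L / c L + real n} (slowness p lam mu)) \<longlonglongrightarrow> L"
      using exists_level_passage_time[OF L(1) slow] by blast
    obtain u u' where "positive_arc p lam L u u'" "u' L = c' L / c L * u L"
      using positive_arc_exists[OF mu(1) L(1) mu(2)] by blast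
    then show ?thesis
      using glued_positive_solution[OF assms(2,3) L_def _ dc dc' csym cpos] by blast
  qed
  moreover have "v x = u x"
    if "is_positive_solution p h lam u" "is_symmetric u"
      "is_positive_solution p h lam v" "is_symmetric v" "x \<in> {0..1}" for lam u v x
    using symmetric_positive_solution_unique[OF that(3,4,1,2) assms that(5)] .
  ultimately show ?thesis
    using positive_solution_lam_less[OF _ assms(2,3)] by meson
qed

end
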